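(* Let $G$ be a topological group, $X$ a space and $\alpha:G\times X\to X$ a continuous $d$-open action. Then there exist a topological group $H$, a continuous action $\gamma:H\times X\to X$, and a compactification $bX$ of $X$ with a continuous action $\tilde\gamma:H\times bX\to bX$ extending $\gamma$ (i.e. $(H,bX,\tilde\gamma)$ is an equivariant compactification of $(H,X,\gamma)$) such that: (1) $w(bX)=w(X)$; (2) $|H|\le w(X)$ and $w(H)\le w(X)$; (3) $\gamma$ is a $d$-open action; (4) the components of the actions $\alpha$ and $\gamma$ coincide.
   Context: All spaces (including topological groups) are Tychonoff. $w(\cdot)$ denotes the weight of a space, i.e. the least cardinality of a base of its topology, and $|H|$ is the cardinality of $H$. A continuous action of a topological group $G$ on $X$ is $d$-open if $x\in\mathrm{int}(\mathrm{cl}(Ox))$ for every $x\in X$ and every open neighborhood $O$ of the unit $e\in G$. If the action is $d$-open, then $X$ is the disjoint union (direct sum) of clopen subsets, called the components of the action, each of which is the closure of the orbit of any of its points.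
   Formalization: In (2) the bounds are |H| ≤ ℵ₀ + w(X) and w(H) ≤ ℵ₀ + w(X), which equal w(X) for infinite X; for finite X the literal bound fails (X empty, or 5 discrete points with Z₆ acting with orbits of sizes 2 and 3). *)

theory Defs
  imports "HOL-Analysis.Analysis" "HOL-Algebra.Group_Action"
begin

unbundle cardinal_syntax

definition tychonoff_space :: "'a topology \<Rightarrow> bool" where
  "tychonoff_space X \<longleftrightarrow> completely_regular_space X \<and> t1_space X"

definition base_of :: "'a set set \<Rightarrow> 'a topology \<Rightarrow> bool" where
  "base_of \<B> X \<longleftrightarrow> openin X = arbitrary union_of (\<lambda>U. U \<in> \<B>)"

definition minimal_base_of :: "'a set set \<Rightarrow> 'a topology \<Rightarrow> bool" where
  "minimal_base_of \<B> X \<longleftrightarrow> base_of \<B> X \<and> (\<forall>\<C>. base_of \<C> X \<longrightarrow> |\<B>| \<le>o |\<C>| )"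

text \<open>Cardinals are represented by cardinal order relations, to be compared up to \<open>=o\<close>.
  The choice is over a nonempty set, see \<open>weight_base\<close> below.\<close>

definition weight :: "'a topology \<Rightarrow> 'a set rel" where
  "weight X = |SOME \<B>. minimal_base_of \<B> X|"

lemma base_of_openin: "base_of {U. openin X U} X"
  unfolding base_of_def by (subst openin_topology_base_unique) auto

lemma minimal_base_exists: "\<exists>\<B>. minimal_base_of \<B> X"
proof -
  let ?R = "card_of ` {\<B>. base_of \<B> X}"
  have "?R \<noteq> {}" using base_of_openin by blast
  moreover have "\<forall>r\<in>?R. Card_order r" by (auto simp: card_of_Card_order)
  ultimately have "\<exists>r\<in>?R. \<forall>r'\<in>?R. r \<le>o r'" by (rule exists_minim_Card_order)
  then show ?thesis by (auto simp: minimal_base_of_def)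
qed

lemma weight_base:
  obtains \<B> where "base_of \<B> X" "weight X = |\<B>|"
    "\<And>\<C>. base_of \<C> X \<Longrightarrow> weight X \<le>o |\<C>|"
  using someI_ex[OF minimal_base_exists[of X]]
  unfolding weight_def minimal_base_of_def by blast

lemma infinite_base:
  assumes "base_of \<B> X" "t1_space X" "infinite (topspace X)"
  shows "infinite \<B>"
proof
  assume "finite \<B>"
  have B: "\<exists>V\<in>\<B>. x \<in> V \<and> V \<subseteq> U" if "openin X U" "x \<in> U" for U x
    using assms(1) that unfolding base_of_def openin_topology_base_unique by blast
  have "inj_on (\<lambda>x. {V \<in> \<B>. x \<in> V}) (topspace X)"
  proof (rule inj_onI, rule ccontr)
    fix x y assume xy: "x \<in> topspace X" "y \<in> topspace X" "x \<noteq> y"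
      and eq: "{V \<in> \<B>. x \<in> V} = {V \<in> \<B>. y \<in> V}"
    obtain U where "openin X U" "x \<in> U" "y \<notin> U"
      using assms(2) xy unfolding t1_space_def by blast
    with B[of U x] eq show False by blast
  qed
  moreover have "(\<lambda>x. {V \<in> \<B>. x \<in> V}) ` topspace X \<subseteq> Pow \<B>" by blast
  ultimately have "finite (topspace X)"
    using \<open>finite \<B>\<close> by (meson finite_Pow_iff inj_on_finite)
  with assms(3) show False by simp
qed

text \<open>For infinite spaces, the cardinal \<open>\<aleph>\<^sub>0 + w(X)\<close> is just \<open>w(X)\<close>.\<close>

lemma weight_absorbs_aleph0:
  assumes "t1_space X" "infinite (topspace X)"
  shows "natLeq +c weight X =o weight X"
proof -
  obtain \<B> where "base_of \<B> X" and w: "weight X = |\<B>|" by (rule weight_base)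
  then have inf: "infinite \<B>" using assms infinite_base by blast
  then have "Cinfinite (weight X)"
    by (simp add: w cinfinite_def Field_card_of card_of_card_order_on)
  moreover have "natLeq \<le>o weight X"
    using inf infinite_iff_natLeq_ordLeq w by auto
  ultimately show ?thesis by (intro csum_absorb2)
qed

text \<open>Topological groups are Tychonoff, like all spaces here.\<close>

definition topological_group :: "('g, 'm) monoid_scheme \<Rightarrow> 'g topology \<Rightarrow> bool" where
  "topological_group G T \<longleftrightarrow>
     group G \<and> topspace T = carrier G \<and> tychonoff_space T \<and>
     continuous_map (prod_topology T T) T (\<lambda>(g, h). g \<otimes>\<^bsub>G\<^esub> h) \<and>
     continuous_map T T (\<lambda>g. inv\<^bsub>G\<^esub> g)"

definition continuous_action ::
    "('g, 'm) monoid_scheme \<Rightarrow> 'g topology \<Rightarrow> 'a topology \<Rightarrow> ('g \<Rightarrow> 'a \<Rightarrow> 'a) \<Rightarrow> bool" where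
  "continuous_action G T X \<phi> \<longleftrightarrow>
     group_action G (topspace X) \<phi> \<and>
     continuous_map (prod_topology T X) X (\<lambda>(g, x). \<phi> g x)"

definition d_open_action ::
    "('g, 'm) monoid_scheme \<Rightarrow> 'g topology \<Rightarrow> 'a topology \<Rightarrow> ('g \<Rightarrow> 'a \<Rightarrow> 'a) \<Rightarrow> bool" where
  "d_open_action G T X \<phi> \<longleftrightarrow>
     continuous_action G T X \<phi> \<and>
     (\<forall>x\<in>topspace X. \<forall>U. openin T U \<and> \<one>\<^bsub>G\<^esub> \<in> U \<longrightarrow>
        x \<in> X interior_of (X closure_of ((\<lambda>g. \<phi> g x) ` U)))"

text \<open>The intended use is for d-open actions, where the orbit closures partition the space.\<close>

definition action_components ::
    "('g, 'm) monoid_scheme \<Rightarrow> 'a topology \<Rightarrow> ('g \<Rightarrow> 'a \<Rightarrow> 'a) \<Rightarrow> 'a set set" where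
  "action_components G X \<phi> = {X closure_of (orbit G \<phi> x) | x. x \<in> topspace X}"

definition compactification :: "'a topology \<Rightarrow> 'b topology \<Rightarrow> ('a \<Rightarrow> 'b) \<Rightarrow> bool" where
  "compactification X Y e \<longleftrightarrow>
     compact_space Y \<and> Hausdorff_space Y \<and> embedding_map X Y e \<and>
     Y closure_of (e ` topspace X) = topspace Y"

definition equivariant_compactification ::
    "('h, 'm) monoid_scheme \<Rightarrow> 'h topology \<Rightarrow> 'a topology \<Rightarrow> ('h \<Rightarrow> 'a \<Rightarrow> 'a) \<Rightarrow>
     'b topology \<Rightarrow> ('h \<Rightarrow> 'b \<Rightarrow> 'b) \<Rightarrow> ('a \<Rightarrow> 'b) \<Rightarrow> bool" where
  "equivariant_compactification H T X \<gamma> Y \<gamma>' e \<longleftrightarrow>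
     continuous_action H T X \<gamma> \<and> continuous_action H T Y \<gamma>' \<and> compactification X Y e \<and>
     (\<forall>h\<in>carrier H. \<forall>x\<in>topspace X. \<gamma>' h (e x) = e (\<gamma> h x))"

text \<open>
  Existence claims in HOL need fixed carrier types. For a space \<open>X\<close> on the type \<open>'a\<close> the following
  choices lose no generality.

  A group acting continuously on \<open>X\<close> and on a compactification of \<open>X\<close> may be divided by the kernel
  of its action on \<open>X\<close>; this increases neither cardinality nor weight, and keeps the orbits and
  d-openness. The quotient acts faithfully, so its elements can be named by functions \<open>'a \<Rightarrow> 'a\<close>.

  A compactification \<open>Y\<close> of \<open>X\<close> embeds into \<open>('a \<Rightarrow> real) \<Rightarrow> real\<close> by sending a point \<open>y\<close> to
  the evaluation at \<open>y\<close> of the continuous extensions to \<open>Y\<close> of functions on \<open>X\<close>.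
\<close>

type_synonym 'a acting_group = "('a \<Rightarrow> 'a) monoid"

type_synonym 'a compactification_point = "('a \<Rightarrow> real) \<Rightarrow> real"

end

theory Submission
  imports Defs
begin

text \<open>
Let \<open>\<kappa>\<close> be \<open>\<aleph>\<^sub>0 + w(X)\<close>. Both \<open>H\<close> and \<open>bX\<close> are built from a family \<open>F\<close> of continuous functions
\<open>X \<rightarrow> [0, 1]\<close> and a group \<open>H\<close> of transformations of \<open>X\<close> taken from the image of \<open>G\<close>, such that \<open>F\<close>
separates points from closed sets and \<open>f \<circ> h \<in> F\<close> for all \<open>f \<in> F\<close> and \<open>h \<in> H\<close>. The compactification is the
closure of \<open>X\<close> in \<open>\<real>\<^sup>F\<close>. The group \<open>H\<close> permutes \<open>F\<close>, hence acts on this closure by permuting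
coordinates. With the topology of uniform convergence \<open>h \<mapsto> f \<circ> h\<close>, \<open>f \<in> F\<close>, it is a topological
group that acts jointly continuously. Its topology is induced by the real functions
\<open>h \<mapsto> sup\<^sub>x \<bar>f (h x) - f (m x)\<bar>\<close> indexed by \<open>F \<times> H\<close>, so that both weights are bounded through the weight
of a power of the real line: they are at most \<open>\<kappa>\<close> once \<open>F\<close> and \<open>H\<close> have size at most \<open>\<kappa>\<close>. For infinite
\<open>X\<close> this gives \<open>w(bX) = w(X)\<close>, since \<open>\<kappa> = w(X)\<close> and \<open>X\<close> embeds into \<open>bX\<close>; a finite \<open>X\<close> equals \<open>bX\<close>.
This is the content of the locale \<open>invariant_function_family\<close>.

Two things remain: enough functions, and a group \<open>H\<close> that is small and yet large enough for d-openness.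

The functions. Say that \<open>f\<close> is uniformly continuous along the action if \<open>f (g x)\<close> is close to \<open>f x\<close>,
uniformly in \<open>x\<close>, for \<open>g\<close> near the unit. For each neighbourhood \<open>W\<close> of the unit of \<open>G\<close> there is an
increasing family of neighbourhoods \<open>B\<^sub>r\<close>, \<open>r > 0\<close>, with \<open>B\<^sub>r B\<^sub>s \<subseteq> B\<^sub>r\<^sub>+\<^sub>s\<close> and \<open>B\<^sub>1 \<subseteq> W\<close>, as
in the Birkhoff-Kakutani metrization theorem. The function \<open>f x = inf {r. x \<in> cl (B\<^sub>r x0)}\<close>, cut off at 1,
is then uniformly continuous along the action, and d-openness makes it
continuous on \<open>X\<close>. These functions separate points from closed sets
(\<open>uniformly_continuous_functions_separating\<close>), and \<open>\<kappa>\<close> many of them, \<open>F0\<close> say, suffice.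

The group. Let \<open>V\<close> be a set of continuous maps \<open>X \<rightarrow> X\<close> and \<open>U\<close> an open set. The union of the
preimages of \<open>U\<close> under the maps in \<open>V\<close> is already the union of at most \<open>\<kappa>\<close> of them, and only \<open>w(X)\<close>
basic sets \<open>U\<close> need be considered. Thus there is \<open>C \<subseteq> V\<close> of size at most \<open>\<kappa>\<close> such that \<open>C x\<close> is dense in \<open>V x\<close> for all points \<open>x\<close> at once (\<open>thin_pointwise_dense_subset\<close>).
A topology of uniform convergence on \<open>\<kappa>\<close> many functions has only \<open>\<kappa>\<close> many basic neighbourhoods \<open>V\<close> of the
unit, each given by finitely many functions \<open>f \<circ> h\<close> with \<open>f \<in> F0\<close>, \<open>h \<in> H\<close>. A closing-off argument
therefore yields a subgroup \<open>H\<close> of size at most \<open>\<kappa>\<close> that contains a set \<open>C\<close> as above for each of these \<open>V\<close>, where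
\<open>V\<close> is formed in the whole image of \<open>G\<close>. Now take \<open>F = {f \<circ> h. f \<in> F0, h \<in> H}\<close>. Uniform continuity
puts a neighbourhood of the unit of \<open>G\<close> into \<open>V\<close>, so \<open>x\<close> is interior to \<open>cl (V x)\<close>. As
\<open>(V \<inter> H) x\<close> is dense in \<open>V x\<close>, the action of \<open>H\<close> is d-open; and as \<open>H x\<close> is dense in \<open>G x\<close>, the
components are the same.
\<close>

section \<open>Cardinalities below a fixed infinite cardinal\<close>

lemma card_of_image_ordLeq: "|A| \<le>o r \<Longrightarrow> |f ` A| \<le>o r"
  by (rule ordLeq_transitive[OF card_of_image])

lemma card_of_subset_ordLeq: "A \<subseteq> B \<Longrightarrow> |B| \<le>o r \<Longrightarrow> |A| \<le>o r"
  by (rule ordLeq_transitive[OF card_of_mono1])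

lemma countable_ordLeq_Cinfinite:
  assumes "countable A" "Cinfinite r"
  shows "|A| \<le>o r"
proof -
  have "|A| \<le>o |UNIV :: nat set|"
    using assms(1) by (auto simp: countable_def card_of_ordLeq[symmetric])
  also have "|UNIV :: nat set| =o natLeq" by (rule card_of_nat)
  also (ordLeq_ordIso_trans) have "natLeq \<le>o r"
    using assms(2) natLeq_ordLeq_cinfinite by blast
  finally (ordLeq_transitive) show ?thesis .
qed

lemma card_of_finite_Cinfinite: "finite A \<Longrightarrow> Cinfinite r \<Longrightarrow> |A| \<le>o r"
  by (rule countable_ordLeq_Cinfinite[OF countable_finite])

lemma Times_Cinfinite_bound: "Cinfinite r \<Longrightarrow> |A| \<le>o r \<Longrightarrow> |B| \<le>o r \<Longrightarrow> |A \<times> B| \<le>o r"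
  by (auto simp: cinfinite_def intro: card_of_Times_ordLeq_infinite_Field)

lemma lists_Cinfinite_bound:
  assumes r: "Cinfinite r" and A: "|A| \<le>o r"
  shows "|lists A| \<le>o r"
proof -
  have *: "|{L \<in> lists A. length L = n}| \<le>o r" for n
  proof (induction n)
    case 0
    have "{L \<in> lists A. length L = 0} = {[]}" by auto
    then show ?case using countable_ordLeq_Cinfinite[OF _ r, of "{[]}"] by simp
  next
    case (Suc n)
    have "{L \<in> lists A. length L = Suc n} \<subseteq> (\<lambda>(a, L). a # L) ` (A \<times> {L \<in> lists A. length L = n})"
      by (auto simp: length_Suc_conv image_iff)
    then show ?case
      by (rule card_of_subset_ordLeq) (intro card_of_image_ordLeq Times_Cinfinite_bound r A Suc)
  qed
  have "lists A = (\<Union>n. {L \<in> lists A. length L = n})" by auto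
  moreover have "|\<Union>n. {L \<in> lists A. length L = n}| \<le>o r"
    by (rule UNION_Cinfinite_bound[OF countable_ordLeq_Cinfinite[OF _ r] _ r]) (use * in auto)
  ultimately show ?thesis by simp
qed

text \<open>
Closing off: iterating the operation \<open>\<omega>\<close> times from the empty set is enough because its arguments are
finite lists, and no step exceeds the infinite cardinal.
\<close>

lemma finitary_closure_exists:
  fixes op :: "'a list \<Rightarrow> 'a set"
  assumes r: "Cinfinite r"
    and op: "\<And>L. L \<in> lists P \<Longrightarrow> op L \<subseteq> P \<and> |op L| \<le>o r"
  obtains H where "H \<subseteq> P" "|H| \<le>o r" "\<And>L. L \<in> lists H \<Longrightarrow> op L \<subseteq> H"
proof
  define K where "K = rec_nat {} (\<lambda>_ A. A \<union> (\<Union>L\<in>lists A. op L))"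
  have K0: "K 0 = {}" and KS: "K (Suc n) = K n \<union> (\<Union>L\<in>lists (K n). op L)" for n
    by (simp_all add: K_def)
  have sub: "K n \<subseteq> P" for n
  proof (induction n)
    case (Suc n)
    then have "op L \<subseteq> P" if "L \<in> lists (K n)" for L using op that by blast
    with Suc show ?case unfolding KS by blast
  qed (simp add: K0)
  have card: "|K n| \<le>o r" for n
  proof (induction n)
    case 0
    show ?case unfolding K0 by (rule countable_ordLeq_Cinfinite[OF _ r]) simp
  next
    case (Suc n)
    have "|op L| \<le>o r" if "L \<in> lists (K n)" for L
      using op that sub[of n] by (meson lists_mono subsetD)
    then have "|\<Union>L\<in>lists (K n). op L| \<le>o r"
      using UNION_Cinfinite_bound lists_Cinfinite_bound[OF r Suc] r by blast
    then show ?case unfolding KS by (rule Un_Cinfinite_bound[OF Suc _ r])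
  qed
  have mono: "K m \<subseteq> K n" if "m \<le> n" for m n
    using lift_Suc_mono_le[of K, OF _ that] unfolding KS by blast
  show "(\<Union>n. K n) \<subseteq> P" using sub by blast
  show "|\<Union>n. K n| \<le>o r"
    by (rule UNION_Cinfinite_bound[OF countable_ordLeq_Cinfinite[OF _ r] _ r]) (use card in auto)
  fix L assume L: "L \<in> lists (\<Union>n. K n)"
  have "\<exists>n. L \<in> lists (K n)"
    using L
  proof (induction L)
    case (Cons a L)
    then obtain m n where "a \<in> K m" "L \<in> lists (K n)" by auto
    then have "a # L \<in> lists (K (max m n))"
      using mono[of m "max m n"] lists_mono[OF mono[of n "max m n"]] by auto
    then show ?case by blast
  qed auto
  then obtain n where "L \<in> lists (K n)" by blast
  then have "op L \<subseteq> K (Suc n)" unfolding KS by blast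
  then show "op L \<subseteq> (\<Union>n. K n)" by blast
qed

section \<open>Weight\<close>

lemma base_ofI:
  assumes "\<And>U. U \<in> \<B> \<Longrightarrow> openin X U"
    and "\<And>U x. openin X U \<Longrightarrow> x \<in> U \<Longrightarrow> \<exists>V\<in>\<B>. x \<in> V \<and> V \<subseteq> U"
  shows "base_of \<B> X"
  unfolding base_of_def openin_topology_base_unique using assms by blast

lemma base_of_imp_openin: "base_of \<B> X \<Longrightarrow> U \<in> \<B> \<Longrightarrow> openin X U"
  unfolding base_of_def openin_topology_base_unique by blast

lemma base_of_refine:
  assumes "base_of \<B> X" "openin X U" "x \<in> U"
  obtains V where "V \<in> \<B>" "x \<in> V" "V \<subseteq> U"
  using assms unfolding base_of_def openin_topology_base_unique by blast

lemma weight_le_card_base: "base_of \<C> X \<Longrightarrow> weight X \<le>o |\<C>|"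
  by (rule weight_base[of X])

lemma weight_embedding_le:
  assumes "embedding_map X Y e"
  shows "weight X \<le>o weight Y"
proof -
  obtain \<B> where \<B>: "base_of \<B> Y" "weight Y = |\<B>|" by (rule weight_base)
  let ?pre = "\<lambda>V. {x \<in> topspace X. e x \<in> V}"
  have e: "homeomorphic_map X (subtopology Y (e ` topspace X)) e"
    using assms by (simp add: embedding_map_def)
  have cont: "continuous_map X Y e"
    using e by (meson continuous_map_in_subtopology homeomorphic_imp_continuous_map)
  have "base_of (?pre ` \<B>) X"
  proof (rule base_ofI)
    fix U assume "U \<in> ?pre ` \<B>"
    then show "openin X U"
      using base_of_imp_openin[OF \<B>(1)] cont by (auto intro: openin_continuous_map_preimage)
  next
    fix U x assume U: "openin X U" "x \<in> U"
    have "openin (subtopology Y (e ` topspace X)) (e ` U)"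
      using e U by (meson homeomorphic_imp_open_map open_map_def)
    then obtain W where W: "openin Y W" "e ` U = W \<inter> e ` topspace X"
      by (auto simp: openin_subtopology)
    have inj: "inj_on e (topspace X)" using e by (simp add: homeomorphic_map_def)
    have UX: "U \<subseteq> topspace X" using U openin_subset by blast
    have "e x \<in> W" using W U by blast
    then obtain V where V: "V \<in> \<B>" "e x \<in> V" "V \<subseteq> W" using base_of_refine[OF \<B>(1) W(1)] by blast
    have "?pre V \<subseteq> U"
    proof
      fix y assume y: "y \<in> ?pre V"
      then have "e y \<in> e ` U" using V W by blast
      then show "y \<in> U" using inj y UX by (auto simp: inj_on_def)
    qed
    moreover have "?pre V \<in> ?pre ` \<B>" using V(1) by (rule imageI)
    moreover have "x \<in> ?pre V" using V(2) U UX by auto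
    ultimately show "\<exists>V\<in>?pre ` \<B>. x \<in> V \<and> V \<subseteq> U" by (intro bexI[of _ "?pre V"] conjI)
  qed
  then have "weight X \<le>o |?pre ` \<B>|" by (rule weight_le_card_base)
  also have "|?pre ` \<B>| \<le>o |\<B>|" by (rule card_of_image)
  finally (ordLeq_transitive) show ?thesis using \<B>(2) by simp
qed

lemma weight_homeomorphic:
  assumes "homeomorphic_map X Y f"
  shows "weight X =o weight Y"
proof -
  obtain g where g: "homeomorphic_maps X Y f g" using assms homeomorphic_map_maps by blast
  then have "homeomorphic_map Y X g" using homeomorphic_maps_map by blast
  then have "embedding_map Y X g"
    by (simp add: embedding_map_def homeomorphic_imp_surjective_map)
  moreover have "embedding_map X Y f"
    using assms by (simp add: embedding_map_def homeomorphic_imp_surjective_map)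
  ultimately show ?thesis unfolding ordIso_iff_ordLeq by (intro conjI weight_embedding_le)
qed

text \<open>
The finite intersections of conditions \<open>a < y k < b\<close> with rational \<open>a\<close>, \<open>b\<close> form a base. They are
coded by finite lists of triples, which bounds their number.
\<close>

lemma weight_euclideanreal_product_le:
  assumes r: "Cinfinite r" and K: "|K| \<le>o r"
  shows "weight (product_topology (\<lambda>_. euclideanreal) K) \<le>o r"
proof -
  let ?P = "product_topology (\<lambda>_. euclideanreal) K"
  define box where "box L = {y \<in> topspace ?P. \<forall>(k, a, b)\<in>set L. real_of_rat a < y k \<and> y k < real_of_rat b}" for L
  let ?I = "lists (K \<times> (UNIV :: (rat \<times> rat) set))"
  have "base_of (box ` ?I) ?P"
  proof (rule base_ofI)
    fix U assume "U \<in> box ` ?I"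
    then obtain L where L: "L \<in> ?I" "U = box L" by blast
    have "openin ?P (box L)"
      using L(1)
    proof (induction L)
      case Nil
      have "box [] = topspace ?P" by (simp add: box_def)
      then show ?case by (metis openin_topspace)
    next
      case (Cons c L)
      obtain k a b where c: "c = (k, a, b)" by (cases c)
      with Cons have k: "k \<in> K" by auto
      have "openin ?P {y \<in> topspace ?P. y k \<in> {real_of_rat a<..<real_of_rat b}}"
        by (rule openin_continuous_map_preimage[OF continuous_map_product_projection[OF k]]) auto
      moreover have "box (c # L) = {y \<in> topspace ?P. y k \<in> {real_of_rat a<..<real_of_rat b}} \<inter> box L"
        by (auto simp: box_def c)
      ultimately show ?case using Cons by auto
    qed
    then show "openin ?P U" using L by simp
  next
    fix U x assume U: "openin ?P U" "x \<in> U"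
    then obtain W where W: "finite {i \<in> K. W i \<noteq> UNIV}" "\<And>i. i \<in> K \<Longrightarrow> open (W i)"
        "x \<in> PiE K W" "PiE K W \<subseteq> U"
      unfolding openin_product_topology_alt by (auto simp: Ball_def) 
    have "\<exists>a b. real_of_rat a < x i \<and> x i < real_of_rat b \<and> {real_of_rat a<..<real_of_rat b} \<subseteq> W i" if i: "i \<in> K" for i
    proof -
      have "x i \<in> W i" using W(3) i by auto
      then obtain e where e: "e > 0" "ball (x i) e \<subseteq> W i"
        using W(2)[OF i] open_contains_ball by blast
      obtain a where a: "x i - e < real_of_rat a" "real_of_rat a < x i"
        using of_rat_dense[of "x i - e" "x i"] e by auto
      obtain b where b: "x i < real_of_rat b" "real_of_rat b < x i + e"
        using of_rat_dense[of "x i" "x i + e"] e by auto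
      have "{real_of_rat a<..<real_of_rat b} \<subseteq> ball (x i) e"
        using a b by (auto simp: dist_real_def abs_if)
      then show ?thesis using a b e by blast
    qed
    then obtain a b where ab: "\<And>i. i \<in> K \<Longrightarrow> real_of_rat (a i) < x i \<and> x i < real_of_rat (b i) \<and> {real_of_rat (a i)<..<real_of_rat (b i)} \<subseteq> W i"
      by metis
    obtain L0 where L0: "set L0 = {i \<in> K. W i \<noteq> UNIV}" using finite_list[OF W(1)] by blast
    define L where "L = map (\<lambda>i. (i, a i, b i)) L0"
    have "set L0 \<subseteq> K" unfolding L0 by blast
    then have "L \<in> ?I" unfolding L_def in_lists_conv_set set_map by blast
    moreover have "x \<in> box L"
      using ab L0 W(3) by (auto simp: box_def L_def topspace_product_topology PiE_def)
    moreover have "box L \<subseteq> U"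
    proof
      fix y assume y: "y \<in> box L"
      have "y i \<in> W i" if i: "i \<in> K" for i
      proof (cases "W i = UNIV")
        case False
        then have "i \<in> set L0" using L0 i by blast
        then have "real_of_rat (a i) < y i \<and> y i < real_of_rat (b i)" using y by (auto simp: box_def L_def)
        then show ?thesis using ab[OF i] by auto
      qed simp
      then have "y \<in> PiE K W" using y by (auto simp: box_def topspace_product_topology PiE_def)
      then show "y \<in> U" using W by blast
    qed
    ultimately show "\<exists>V\<in>box ` ?I. x \<in> V \<and> V \<subseteq> U" by blast
  qed
  then have "weight ?P \<le>o |box ` ?I|" by (rule weight_le_card_base)
  also have "|box ` ?I| \<le>o r"
    by (intro card_of_image_ordLeq lists_Cinfinite_bound Times_Cinfinite_bound r K countable_ordLeq_Cinfinite) auto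
  finally (ordLeq_transitive) show ?thesis .
qed

section \<open>Topologies induced by families of real functions\<close>

text \<open>
Maps into the spaces of functions and transformations below are continuous because the increments of
their coordinates are bounded by functions already known to be continuous. This form of the criterion
avoids any handling of neighbourhoods there.
\<close>

lemma continuous_map_real_dominated:
  assumes "\<And>z0. z0 \<in> topspace Z \<Longrightarrow> \<exists>v. continuous_map Z euclideanreal v \<and> v z0 = 0 \<and>
      (\<forall>z\<in>topspace Z. \<bar>u z - u z0\<bar> \<le> v z)"
  shows "continuous_map Z euclideanreal u"
  unfolding continuous_map_def
proof (intro conjI allI impI)
  fix W :: "real set" assume "openin euclideanreal W"
  then have W: "open W" by simp
  show "openin Z {z \<in> topspace Z. u z \<in> W}"
  proof (subst openin_subopen, intro ballI)
    fix z0 assume z0: "z0 \<in> {z \<in> topspace Z. u z \<in> W}"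
    then obtain \<epsilon> where \<epsilon>: "\<epsilon> > 0" "ball (u z0) \<epsilon> \<subseteq> W" using W open_contains_ball by blast
    from z0 assms obtain v where v: "continuous_map Z euclideanreal v" "v z0 = 0"
      "\<forall>z\<in>topspace Z. \<bar>u z - u z0\<bar> \<le> v z" by blast
    have "openin Z {z \<in> topspace Z. v z \<in> {..<\<epsilon>}}"
      by (rule openin_continuous_map_preimage[OF v(1)]) simp
    moreover have "z0 \<in> {z \<in> topspace Z. v z \<in> {..<\<epsilon>}}" using z0 v(2) \<epsilon>(1) by simp
    moreover have "{z \<in> topspace Z. v z \<in> {..<\<epsilon>}} \<subseteq> {z \<in> topspace Z. u z \<in> W}"
    proof
      fix z assume z: "z \<in> {z \<in> topspace Z. v z \<in> {..<\<epsilon>}}"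
      then have "\<bar>u z - u z0\<bar> < \<epsilon>" using v(3) by fastforce
      then have "u z \<in> ball (u z0) \<epsilon>" by (simp add: dist_real_def abs_minus_commute)
      then show "z \<in> {z \<in> topspace Z. u z \<in> W}" using z \<epsilon>(2) by blast
    qed
    ultimately show "\<exists>T. openin Z T \<and> z0 \<in> T \<and> T \<subseteq> {z \<in> topspace Z. u z \<in> W}" by blast
  qed
qed simp

lemma tychonoff_space_embedding:
  assumes "embedding_map X Y e" "tychonoff_space Y"
  shows "tychonoff_space X"
proof -
  have "X homeomorphic_space subtopology Y (e ` topspace X)"
    using assms(1) embedding_map_imp_homeomorphic_space by blast
  then show ?thesis
    using assms(2) unfolding tychonoff_space_def
    by (metis completely_regular_space_subtopology homeomorphic_completely_regular_space
        homeomorphic_t1_space t1_space_subtopology)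
qed

lemma tychonoff_space_euclideanreal_product:
  "tychonoff_space (product_topology (\<lambda>_. euclideanreal) K)"
  unfolding tychonoff_space_def
proof
  have "completely_regular_space euclideanreal"
    by (metis metrizable_imp_completely_regular_space metrizable_space_euclidean)
  then show "completely_regular_space (powertop_real K)" 
    by (simp add: completely_regular_space_product_topology)
  show "t1_space (powertop_real K)"
    by (simp add: t1_space_product_topology Hausdorff_imp_t1_space)
qed

lemma embedding_map_pullback_topology:
  assumes "inj_on f A" "f ` A \<subseteq> topspace T"
  shows "embedding_map (pullback_topology A f T) T f"
proof -
  let ?S = "pullback_topology A f T"
  have S: "topspace ?S = A" using assms(2) by (auto simp: topspace_pullback_topology)
  have "homeomorphic_map ?S (subtopology T (f ` A)) f"
  proof (rule bijective_open_imp_homeomorphic_map)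
    have "continuous_map ?S T f"
      using continuous_map_pullback[OF continuous_map_id, of A f T] by simp
    then show "continuous_map ?S (subtopology T (f ` A)) f"
      by (auto simp: continuous_map_in_subtopology S)
    show "open_map ?S (subtopology T (f ` A)) f"
      unfolding open_map_def openin_pullback_topology openin_subtopology by blast
    show "f ` topspace ?S = topspace (subtopology T (f ` A))"
      using assms(2) S by auto
    show "inj_on f (topspace ?S)" using assms(1) S by simp
  qed
  then show ?thesis by (simp add: embedding_map_def S)
qed

text \<open>
The classical embedding into a power of the line. Separation of points from closed sets with a gap at
\<open>1/2\<close> makes the map open onto its image: \<open>{y. y f < 1/2}\<close> cuts out a part of the image of \<open>U\<close>.
\<close>

lemma embedding_map_separating:
  assumes cont: "\<And>f. f \<in> F \<Longrightarrow> continuous_map X euclideanreal f"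
    and t1: "t1_space X"
    and sep: "\<And>U x. openin X U \<Longrightarrow> x \<in> U \<Longrightarrow> \<exists>f\<in>F. f x < 1/2 \<and> (\<forall>y\<in>topspace X - U. f y \<ge> 1/2)"
  shows "embedding_map X (product_topology (\<lambda>_. euclideanreal) F) (\<lambda>x. \<lambda>f\<in>F. f x)"
proof -
  let ?P = "product_topology (\<lambda>_. euclideanreal) F"
  let ?e = "\<lambda>x. \<lambda>f\<in>F. f x"
  have cont_e: "continuous_map X ?P ?e"
    unfolding continuous_map_componentwise using cont by auto
  have "homeomorphic_map X (subtopology ?P (?e ` topspace X)) ?e"
  proof (rule bijective_open_imp_homeomorphic_map)
    show "continuous_map X (subtopology ?P (?e ` topspace X)) ?e"
      using cont_e by (auto simp: continuous_map_in_subtopology)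
    show "?e ` topspace X = topspace (subtopology ?P (?e ` topspace X))"
      by auto
    show "inj_on ?e (topspace X)"
    proof (rule inj_onI, rule ccontr)
      fix x y assume xy: "x \<in> topspace X" "y \<in> topspace X" "?e x = ?e y" "x \<noteq> y"
      obtain U where U: "openin X U" "x \<in> U" "y \<notin> U"
        using t1 xy unfolding t1_space_def by blast
      obtain f where f: "f \<in> F" "f x < 1/2" "\<forall>y\<in>topspace X - U. f y \<ge> 1/2"
        using sep[OF U(1,2)] by blast
      have "f x = f y" using fun_cong[OF xy(3), of f] f(1) by simp
      moreover have "f y \<ge> 1/2" using f(3) xy(2) U(3) by blast
      ultimately show False using f(2) by simp
    qed
    show "open_map X (subtopology ?P (?e ` topspace X)) ?e"
      unfolding open_map_def
    proof (intro allI impI)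
      fix U assume U: "openin X U"
      show "openin (subtopology ?P (?e ` topspace X)) (?e ` U)"
      proof (subst openin_subopen, intro ballI)
        fix q assume "q \<in> ?e ` U"
        then obtain x where x: "x \<in> U" "q = ?e x" by blast
        obtain f where f: "f \<in> F" "f x < 1/2" "\<forall>y\<in>topspace X - U. f y \<ge> 1/2"
          using sep[OF U x(1)] by blast
        have "openin ?P {p \<in> topspace ?P. p f \<in> {..<1/2}}"
          by (rule openin_continuous_map_preimage[OF continuous_map_product_projection[OF f(1)]]) simp
        then have "openin (subtopology ?P (?e ` topspace X)) (?e ` topspace X \<inter> {p \<in> topspace ?P. p f \<in> {..<1/2}})"
          by (rule openin_subtopology_Int2)
        moreover have "q \<in> ?e ` topspace X \<inter> {p \<in> topspace ?P. p f \<in> {..<1/2}}"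
          using x f openin_subset[OF U] by auto
        moreover have "?e ` topspace X \<inter> {p \<in> topspace ?P. p f \<in> {..<1/2}} \<subseteq> ?e ` U"
        proof
          fix p assume p: "p \<in> ?e ` topspace X \<inter> {p \<in> topspace ?P. p f \<in> {..<1/2}}"
          then obtain y where y: "y \<in> topspace X" "p = ?e y" by blast
          then have "f y < 1/2" using p f(1) by simp
          then have "y \<in> U" using f(3) y(1) by force
          then show "p \<in> ?e ` U" using y(2) by blast
        qed
        ultimately show "\<exists>T. openin (subtopology ?P (?e ` topspace X)) T \<and> q \<in> T \<and> T \<subseteq> ?e ` U"
          by blast
      qed
    qed
  qed
  then show ?thesis by (simp add: embedding_map_def)
qed

section \<open>Actions of topological groups\<close>

text \<open>
Bijectivity of \<open>\<phi> g\<close> comes from \<open>\<phi> (inv g)\<close>, which is inverse to it by the laws of an action.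
\<close>

lemma group_actionI:
  fixes G (structure)
  assumes G: "group G"
    and ext: "\<And>g. g \<in> carrier G \<Longrightarrow> \<phi> g \<in> extensional E"
    and closed: "\<And>g x. g \<in> carrier G \<Longrightarrow> x \<in> E \<Longrightarrow> \<phi> g x \<in> E"
    and one: "\<And>x. x \<in> E \<Longrightarrow> \<phi> \<one> x = x"
    and mult: "\<And>g h x. g \<in> carrier G \<Longrightarrow> h \<in> carrier G \<Longrightarrow> x \<in> E \<Longrightarrow> \<phi> (g \<otimes> h) x = \<phi> g (\<phi> h x)"
  shows "group_action G E \<phi>"
proof -
  interpret group G by (rule G)
  have Bij: "\<phi> g \<in> Bij E" if g: "g \<in> carrier G" for g
  proof -
    have "\<phi> (inv g) (\<phi> g x) = x" "\<phi> g (\<phi> (inv g) x) = x" if "x \<in> E" for x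
      using mult[of "inv g" g x] mult[of g "inv g" x] g that one by auto
    then have "bij_betw (\<phi> g) E E"
      using g closed by (intro bij_betw_byWitness[of _ "\<phi> (inv g)"]) auto
    then show ?thesis using ext[OF g] by (simp add: Bij_def)
  qed
  have "\<phi> \<in> hom G (BijGroup E)"
  proof (rule homI)
    show "\<phi> g \<in> carrier (BijGroup E)" if "g \<in> carrier G" for g
      using Bij[OF that] by (simp add: BijGroup_def)
    show "\<phi> (g \<otimes> h) = \<phi> g \<otimes>\<^bsub>BijGroup E\<^esub> \<phi> h" if gh: "g \<in> carrier G" "h \<in> carrier G" for g h
    proof -
      have "\<phi> (g \<otimes> h) = compose E (\<phi> g) (\<phi> h)"
        by (rule extensionalityI[of _ E]) (use gh mult ext in \<open>auto simp: compose_def\<close>)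
      then show ?thesis using Bij gh by (simp add: BijGroup_def)
    qed
  qed
  then show ?thesis
    by (simp add: group_action_def group_hom_def group_hom_axioms_def G group_BijGroup)
qed

lemma continuous_action_map:
  assumes "topspace T = carrier G" "continuous_action G T X \<phi>" "g \<in> carrier G"
  shows "continuous_map X X (\<phi> g)"
proof -
  have "continuous_map X (prod_topology T X) (\<lambda>x. (g, x))"
    using assms by (auto intro!: continuous_map_pairedI)
  moreover have "continuous_map (prod_topology T X) X (\<lambda>(g, x). \<phi> g x)"
    using assms by (simp add: continuous_action_def)
  ultimately have "continuous_map X X ((\<lambda>(g, x). \<phi> g x) \<circ> (\<lambda>x. (g, x)))" by (rule continuous_map_compose)
  then show ?thesis by (simp add: o_def)
qed

section \<open>Uniformly continuous functions for a d-open action\<close>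

definition dyadic_weight :: "(nat \<times> 'a) list \<Rightarrow> real" where
  "dyadic_weight L = (\<Sum>(n, _)\<leftarrow>L. 1 / 2 ^ n)"

lemma dyadic_weight_simps [simp]:
  "dyadic_weight [] = 0"
  "dyadic_weight ((n, g) # L) = 1 / 2 ^ n + dyadic_weight L"
  "dyadic_weight (L @ L') = dyadic_weight L + dyadic_weight L'"
  by (simp_all add: dyadic_weight_def)

lemma dyadic_weight_nonneg: "0 \<le> dyadic_weight L"
  by (induction L) auto

text \<open>
Cut the list at the first entry after which the rest weighs less than \<open>b\<close>; unless it heads the list, the
rest including it weighs at least \<open>b\<close>, so less than \<open>a\<close> is left for what precedes it. Removing one entry in this way lets a word of weight below \<open>2\<^sup>-\<^sup>m\<close> be seen as a
product of three factors from the next neighbourhood.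
\<close>

lemma dyadic_weight_split:
  assumes "L \<noteq> []" "0 < a" "0 < b" "dyadic_weight L < a + b"
  shows "\<exists>L1 c L2. L = L1 @ c # L2 \<and> dyadic_weight L1 < a \<and> dyadic_weight L2 < b"
  using assms
proof (induction L arbitrary: a)
  case (Cons c L)
  obtain n g where c: "c = (n, g)" by (cases c)
  show ?case
  proof (cases "dyadic_weight L < b")
    case True
    then show ?thesis using Cons.prems by (intro exI[of _ "[]"]) auto
  next
    case False
    then have "L \<noteq> []" using Cons.prems by auto
    moreover have "0 < a - 1 / 2 ^ n" "dyadic_weight L < (a - 1 / 2 ^ n) + b"
      using False Cons.prems c by auto
    ultimately obtain L1 c' L2 where "L = L1 @ c' # L2" "dyadic_weight L1 < a - 1 / 2 ^ n" "dyadic_weight L2 < b"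
      using Cons.IH Cons.prems by blast
    then have "c # L = (c # L1) @ c' # L2 \<and> dyadic_weight (c # L1) < a \<and> dyadic_weight L2 < b"
      by (simp add: c)
    then show ?thesis by blast
  qed
qed simp

text \<open>
The sequence of neighbourhoods that starts the Birkhoff-Kakutani construction. Cubes rather than
squares are required to shrink, for the sake of splitting a word into two parts and a middle letter.
\<close>

locale dyadic_neighbourhoods = group G for G (structure) +
  fixes N :: "nat \<Rightarrow> 'a set"
  assumes N_carrier: "N n \<subseteq> carrier G"
    and N_one: "\<one> \<in> N n"
    and N_inv: "g \<in> N n \<Longrightarrow> inv g \<in> N n"
    and N_cube: "a \<in> N (Suc n) \<Longrightarrow> b \<in> N (Suc n) \<Longrightarrow> c \<in> N (Suc n) \<Longrightarrow> a \<otimes> b \<otimes> c \<in> N n"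
begin

definition word_prod :: "(nat \<times> 'a) list \<Rightarrow> 'a" where
  "word_prod L = foldr (\<lambda>(_, g) h. g \<otimes> h) L \<one>"

definition words :: "(nat \<times> 'a) list set" where
  "words = lists {(n, g). g \<in> N n}"

text \<open>
The elements of length less than \<open>r\<close>, where each factor from \<open>N n\<close> costs \<open>2\<^sup>-\<^sup>n\<close>. Words of weights
below \<open>r\<close> and \<open>s\<close> concatenate to one of weight below \<open>r + s\<close>, so multiplication is subadditive by
construction; that small balls are really small is the lemma \<open>word_prod_in_N\<close>.
\<close>

definition dyadic_ball :: "real \<Rightarrow> 'a set" where
  "dyadic_ball r = word_prod ` {L \<in> words. dyadic_weight L < r}"

lemma word_prod_simps [simp]:
  "word_prod [] = \<one>" "word_prod ((n, g) # L) = g \<otimes> word_prod L"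
  by (simp_all add: word_prod_def)

lemma word_prod_closed: "L \<in> words \<Longrightarrow> word_prod L \<in> carrier G"
proof (induction L)
  case (Cons c L)
  then show ?case using N_carrier by (cases c) (auto simp: words_def)
qed simp

lemma word_prod_append:
  "L \<in> words \<Longrightarrow> L' \<in> words \<Longrightarrow> word_prod (L @ L') = word_prod L \<otimes> word_prod L'"
proof (induction L)
  case Nil
  then show ?case using word_prod_closed by simp
next
  case (Cons c L)
  obtain n g where c: "c = (n, g)" by (cases c)
  have "g \<in> carrier G" "L \<in> words" using Cons.prems N_carrier by (auto simp: words_def c)
  then show ?case using Cons word_prod_closed by (simp add: c m_assoc)
qed

lemma N_Suc_subset: "N (Suc n) \<subseteq> N n"
proof
  fix g assume g: "g \<in> N (Suc n)"
  then have "g \<otimes> \<one> \<otimes> \<one> \<in> N n" using N_cube N_one by blast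
  moreover have "g \<in> carrier G" using g N_carrier by blast
  ultimately show "g \<in> N n" by simp
qed

lemma N_antimono: "m \<le> n \<Longrightarrow> N n \<subseteq> N m"
  using lift_Suc_antimono_le[of N] N_Suc_subset by blast

text \<open>
Induction on the length. Splitting at half the admissible weight leaves two shorter words, which lie in
\<open>N (Suc m)\<close>, and a middle letter; its weight is below \<open>2\<^sup>-\<^sup>m\<close>, hence at most \<open>2\<^sup>-\<^sup>m\<^sup>-\<^sup>1\<close>, and so
it lies in \<open>N (Suc m)\<close> too.
\<close>

lemma word_prod_in_N:
  assumes "L \<in> words" "dyadic_weight L < 1 / 2 ^ m"
  shows "word_prod L \<in> N m"
  using assms
proof (induction "length L" arbitrary: L m rule: less_induct)
  case less
  show ?case
  proof (cases "L = []")
    case True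
    then show ?thesis by (simp add: N_one)
  next
    case False
    have "dyadic_weight L < 1 / 2 ^ Suc m + 1 / 2 ^ Suc m" using less.prems by simp
    then obtain L1 c L2 where L: "L = L1 @ c # L2"
      "dyadic_weight L1 < 1 / 2 ^ Suc m" "dyadic_weight L2 < 1 / 2 ^ Suc m"
      using dyadic_weight_split[OF False, of "1 / 2 ^ Suc m" "1 / 2 ^ Suc m"] by auto
    obtain n g where c: "c = (n, g)" by (cases c)
    have w: "L1 \<in> words" "L2 \<in> words" "g \<in> N n" using less.prems(1) by (auto simp: L(1) c words_def)
    have "1 / 2 ^ n \<le> dyadic_weight L"
      using dyadic_weight_nonneg[of L1] dyadic_weight_nonneg[of L2] by (simp add: L(1) c)
    then have "1 / 2 ^ n < (1::real) / 2 ^ m" using less.prems(2) by simp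
    then have "(2::real) ^ m < 2 ^ n" by (simp add: field_simps)
    then have "Suc m \<le> n" by simp
    then have g: "g \<in> N (Suc m)" using w N_antimono by blast
    have "word_prod L1 \<in> N (Suc m)" "word_prod L2 \<in> N (Suc m)"
      using less.hyps[OF _ w(1) L(2)] less.hyps[OF _ w(2) L(3)] by (auto simp: L(1))
    then have "word_prod L1 \<otimes> g \<otimes> word_prod L2 \<in> N m" using N_cube g by blast
    moreover have "word_prod L = word_prod L1 \<otimes> g \<otimes> word_prod L2"
    proof -
      have "c # L2 \<in> words" using w by (auto simp: words_def c)
      moreover have "g \<in> carrier G" using w N_carrier by blast
      ultimately show ?thesis
        using w by (simp add: L(1) word_prod_append word_prod_closed c m_assoc)
    qed
    ultimately show ?thesis by simp
  qed
qed

lemma dyadic_ball_carrier: "dyadic_ball r \<subseteq> carrier G"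
  using word_prod_closed by (auto simp: dyadic_ball_def)

lemma dyadic_ball_mono: "r \<le> s \<Longrightarrow> dyadic_ball r \<subseteq> dyadic_ball s"
  by (auto simp: dyadic_ball_def)

lemma one_in_dyadic_ball: "0 < r \<Longrightarrow> \<one> \<in> dyadic_ball r"
  unfolding dyadic_ball_def by (rule image_eqI[of _ _ "[]"]) (auto simp: words_def)

lemma dyadic_ball_1_subset: "dyadic_ball 1 \<subseteq> N 0"
  using word_prod_in_N[of _ 0] by (auto simp: dyadic_ball_def)

lemma N_mult_dyadic_ball:
  assumes "g \<in> N n" "h \<in> dyadic_ball r"
  shows "g \<otimes> h \<in> dyadic_ball (r + 1 / 2 ^ n)"
proof -
  obtain L where "L \<in> words" "dyadic_weight L < r" "h = word_prod L"
    using assms(2) by (auto simp: dyadic_ball_def)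
  then show ?thesis
    unfolding dyadic_ball_def using assms(1)
    by (intro image_eqI[of _ _ "(n, g) # L"]) (auto simp: words_def)
qed

end

lemma topological_group_cube_root:
  assumes TG: "topological_group G T" and O: "openin T U" "\<one>\<^bsub>G\<^esub> \<in> U"
  obtains V where "openin T V" "\<one>\<^bsub>G\<^esub> \<in> V" "\<And>g. g \<in> V \<Longrightarrow> inv\<^bsub>G\<^esub> g \<in> V"
    "\<And>a b c. a \<in> V \<Longrightarrow> b \<in> V \<Longrightarrow> c \<in> V \<Longrightarrow> a \<otimes>\<^bsub>G\<^esub> b \<otimes>\<^bsub>G\<^esub> c \<in> U"
proof -
  interpret group G using TG by (simp add: topological_group_def)
  have car: "topspace T = carrier G" using TG by (simp add: topological_group_def)
  have square_root: "\<exists>V. openin T V \<and> \<one>\<^bsub>G\<^esub> \<in> V \<and> (\<forall>a\<in>V. \<forall>b\<in>V. a \<otimes>\<^bsub>G\<^esub> b \<in> W)"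
    if W: "openin T W" "\<one>\<^bsub>G\<^esub> \<in> W" for W
  proof -
    let ?M = "{p \<in> topspace (prod_topology T T). (\<lambda>(g, h). g \<otimes>\<^bsub>G\<^esub> h) p \<in> W}"
    have "openin (prod_topology T T) ?M"
      using TG W(1) unfolding topological_group_def by (blast intro: openin_continuous_map_preimage)
    moreover have "(\<one>\<^bsub>G\<^esub>, \<one>\<^bsub>G\<^esub>) \<in> ?M" using W car by simp
    ultimately obtain A B where "openin T A" "openin T B" "\<one>\<^bsub>G\<^esub> \<in> A" "\<one>\<^bsub>G\<^esub> \<in> B" "A \<times> B \<subseteq> ?M"
      unfolding openin_prod_topology_alt by meson
    then show ?thesis by (intro exI[of _ "A \<inter> B"]) auto
  qed
  obtain V1 where V1: "openin T V1" "\<one>\<^bsub>G\<^esub> \<in> V1" "\<forall>a\<in>V1. \<forall>b\<in>V1. a \<otimes>\<^bsub>G\<^esub> b \<in> U"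
    using square_root[OF O] by blast
  obtain V2 where V2: "openin T V2" "\<one>\<^bsub>G\<^esub> \<in> V2" "\<forall>a\<in>V2. \<forall>b\<in>V2. a \<otimes>\<^bsub>G\<^esub> b \<in> V1"
    using square_root[OF V1(1,2)] by blast
  \<comment> \<open>A product of two elements of \<open>V2\<close> lies in \<open>V1\<close>, and so does the third factor because the unit is in \<open>V2\<close>.\<close>
  let ?V = "V2 \<inter> {g \<in> topspace T. inv\<^bsub>G\<^esub> g \<in> V2}"
  have V2c: "V2 \<subseteq> carrier G" using openin_subset[OF V2(1)] car by simp
  show thesis
  proof
    have "openin T {g \<in> topspace T. inv\<^bsub>G\<^esub> g \<in> V2}"
      using TG V2(1) unfolding topological_group_def by (blast intro: openin_continuous_map_preimage)
    then show "openin T ?V" using V2 by blast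
    show "\<one>\<^bsub>G\<^esub> \<in> ?V" using V2 car by simp
    show "inv\<^bsub>G\<^esub> g \<in> ?V" if "g \<in> ?V" for g using that V2c car by auto
    show "a \<otimes>\<^bsub>G\<^esub> b \<otimes>\<^bsub>G\<^esub> c \<in> U" if abc: "a \<in> ?V" "b \<in> ?V" "c \<in> ?V" for a b c
    proof -
      have "\<one>\<^bsub>G\<^esub> \<otimes>\<^bsub>G\<^esub> c \<in> V1" using V2(2,3) abc by blast
      then have "c \<in> V1" using abc V2c by auto
      then show ?thesis using V1(3) V2(3) abc by blast
    qed
  qed
qed

lemma topological_group_dyadic_neighbourhoods:
  assumes TG: "topological_group G T" and U: "openin T U" "\<one>\<^bsub>G\<^esub> \<in> U"
  obtains N where "dyadic_neighbourhoods G N" "N 0 \<subseteq> U" "\<And>n. openin T (N n)"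
proof -
  interpret group G using TG by (simp add: topological_group_def)
  have car: "topspace T = carrier G" using TG by (simp add: topological_group_def)
  let ?P = "\<lambda>V. openin T V \<and> \<one>\<^bsub>G\<^esub> \<in> V \<and> (\<forall>g\<in>V. inv\<^bsub>G\<^esub> g \<in> V) \<and> V \<subseteq> U"
  have "\<exists>V. ?P V \<and> (\<forall>a\<in>V. \<forall>b\<in>V. \<forall>c\<in>V. a \<otimes>\<^bsub>G\<^esub> b \<otimes>\<^bsub>G\<^esub> c \<in> W)"
    if W: "openin T W" "\<one>\<^bsub>G\<^esub> \<in> W" "W \<subseteq> U" for W
  proof -
    obtain V where V: "openin T V" "\<one>\<^bsub>G\<^esub> \<in> V" "\<And>g. g \<in> V \<Longrightarrow> inv\<^bsub>G\<^esub> g \<in> V"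
      "\<And>a b c. a \<in> V \<Longrightarrow> b \<in> V \<Longrightarrow> c \<in> V \<Longrightarrow> a \<otimes>\<^bsub>G\<^esub> b \<otimes>\<^bsub>G\<^esub> c \<in> W"
      using topological_group_cube_root[OF TG W(1,2)] by blast
    have "V \<subseteq> W"
    proof
      fix g assume g: "g \<in> V"
      then have "g \<otimes>\<^bsub>G\<^esub> \<one>\<^bsub>G\<^esub> \<otimes>\<^bsub>G\<^esub> \<one>\<^bsub>G\<^esub> \<in> W" using V by blast
      then show "g \<in> W" using g openin_subset[OF V(1)] car by auto
    qed
    then have "?P V" using V(1-3) W(3) by blast
    then show ?thesis using V(4) by (intro exI[of _ V]) blast
  qed
  note step = this
  have "\<exists>N. \<forall>n. ?P (N n) \<and>
      (\<forall>a\<in>N (Suc n). \<forall>b\<in>N (Suc n). \<forall>c\<in>N (Suc n). a \<otimes>\<^bsub>G\<^esub> b \<otimes>\<^bsub>G\<^esub> c \<in> N n)"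
  proof (rule dependent_nat_choice)
    show "\<exists>V. ?P V" using step[OF U] by blast
  next
    fix W n assume "?P W"
    then show "\<exists>V. ?P V \<and> (\<forall>a\<in>V. \<forall>b\<in>V. \<forall>c\<in>V. a \<otimes>\<^bsub>G\<^esub> b \<otimes>\<^bsub>G\<^esub> c \<in> W)"
      using step[of W] by blast
  qed
  then obtain N where N': "\<forall>n. ?P (N n) \<and>
      (\<forall>a\<in>N (Suc n). \<forall>b\<in>N (Suc n). \<forall>c\<in>N (Suc n). a \<otimes>\<^bsub>G\<^esub> b \<otimes>\<^bsub>G\<^esub> c \<in> N n)"
    by (elim exE)
  note N = conjunct1[OF spec[OF N']] conjunct2[OF spec[OF N']]
  have "dyadic_neighbourhoods G N"
  proof
    show "N n \<subseteq> carrier G" for n using N(1)[of n] openin_subset[of T] car by blast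
  qed (use N in auto)
  then show thesis using that N by blast
qed

text \<open>
The function \<open>f y = inf {r. y \<in> cl (B\<^sub>r x0)}\<close>, cut off at 1, measures how far \<open>y\<close> is from \<open>x0\<close> along
the action. Moving a point by an element of \<open>N n\<close> enlarges the radius by at most \<open>2\<^sup>-\<^sup>n\<close>, which gives
uniform continuity along the action. The nontrivial sublevel sets are intersections of the closed
sets \<open>cl (B\<^sub>r x0)\<close>, so \<open>f\<close> is lower semicontinuous. Upper semicontinuity is where d-openness enters:
\<open>f\<close> is at most \<open>f y + 2\<^sup>-\<^sup>n\<close> on \<open>N n y\<close>, hence on its closure, which is a neighbourhood of \<open>y\<close>.
\<close>

lemma d_open_action_separating_function:
  fixes G (structure)
  assumes TG: "topological_group G T" and X: "tychonoff_space X"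
    and act: "d_open_action G T X \<phi>" and U: "openin X U" "x0 \<in> U"
  obtains f :: "'a \<Rightarrow> real" where "continuous_map X euclideanreal f"
    "\<And>y. 0 \<le> f y \<and> f y \<le> 1" "f x0 = 0" "\<And>y. y \<in> topspace X - U \<Longrightarrow> f y = 1"
    "\<And>\<epsilon>. \<epsilon> > 0 \<Longrightarrow> \<exists>V. openin T V \<and> \<one> \<in> V \<and>
        (\<forall>g\<in>V. \<forall>y\<in>topspace X. \<bar>f (\<phi> g y) - f y\<bar> < \<epsilon>)"
proof -
  let ?E = "topspace X"
  have grp: "group G" and car: "topspace T = carrier G" using TG by (auto simp: topological_group_def)
  have cact: "continuous_action G T X \<phi>" using act by (simp add: d_open_action_def)
  interpret group_action G ?E \<phi> using cact by (simp add: continuous_action_def)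
  have cont_pair: "continuous_map (prod_topology T X) X (\<lambda>(g, x). \<phi> g x)"
    using cact by (simp add: continuous_action_def)
  have cont1: "continuous_map X X (\<phi> g)" if "g \<in> carrier G" for g
    using continuous_action_map[OF car cact that] .
  have x0: "x0 \<in> ?E" using U openin_subset by blast
  have cont2: "continuous_map T X (\<lambda>g. \<phi> g x0)"
  proof -
    have "continuous_map T (prod_topology T X) (\<lambda>g. (g, x0))"
      using x0 by (auto intro!: continuous_map_pairedI)
    from continuous_map_compose[OF this cont_pair] show ?thesis by (simp add: o_def)
  qed
  have "regular_space X" using X completely_regular_imp_regular_space by (auto simp: tychonoff_space_def)
  moreover have "closedin X (?E - U)" "x0 \<in> ?E - (?E - U)" using U x0 by auto
  ultimately obtain V where V: "openin X V" "x0 \<in> V" "disjnt (?E - U) (X closure_of V)"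
    unfolding regular_space by meson
  have clV: "X closure_of V \<subseteq> U"
    using V(3) closure_of_subset_topspace[of X V] by (auto simp: disjnt_def)
  let ?U = "{g \<in> topspace T. \<phi> g x0 \<in> V}"
  have one_x0: "\<phi> \<one> x = x" if "x \<in> ?E" for x using id_eq_one that by (metis restrict_apply')
  have "openin T ?U" by (rule openin_continuous_map_preimage[OF cont2 V(1)])
  moreover have "\<one> \<in> ?U" using one_x0[OF x0] V car group.is_monoid[OF grp] by (simp add: monoid.one_closed)
  ultimately obtain N where N: "dyadic_neighbourhoods G N" "N 0 \<subseteq> ?U" "\<And>n. openin T (N n)"
    using topological_group_dyadic_neighbourhoods[OF TG] by blast
  interpret dyadic_neighbourhoods G N by (rule N(1))
  define C where "C r = X closure_of ((\<lambda>g. \<phi> g x0) ` dyadic_ball r)" for r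
  \<comment> \<open>Inserting \<open>1\<close> cuts the function off and keeps the infimum meaningful where no radius occurs.\<close>
  define f where "f y = Inf (insert 1 {r. 0 < r \<and> y \<in> C r})" for y
  have bdd: "bdd_below (insert 1 {r. 0 < r \<and> y \<in> C r})" for y
    by (rule bdd_belowI[of _ 0]) auto
  have C_mono: "C r \<subseteq> C s" if "r \<le> s" for r s
    unfolding C_def by (intro closure_of_mono image_mono dyadic_ball_mono that)
  have f_le: "f y \<le> r" if "0 < r" "y \<in> C r" for y r
    unfolding f_def by (rule cInf_lower[OF _ bdd]) (use that in auto)
  have f_0_1: "0 \<le> f y \<and> f y \<le> 1" for y
    unfolding f_def by (auto intro!: cInf_greatest cInf_lower[OF _ bdd, of 1])
  have f_less: "\<exists>r. 0 < r \<and> r < a \<and> y \<in> C r" if fy: "f y < a" "a \<le> 1" for y a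
  proof -
    have "\<exists>r\<in>insert 1 {r. 0 < r \<and> y \<in> C r}. r < a"
      using cInf_less_iff[OF insert_not_empty bdd, of y a] fy(1) by (simp only: f_def)
    then show ?thesis using fy(2) by auto
  qed
  have f_x0: "f x0 = 0"
  proof (rule ccontr)
    assume "f x0 \<noteq> 0"
    then have pos: "0 < f x0" using f_0_1[of x0] by simp
    have "x0 \<in> (\<lambda>g. \<phi> g x0) ` dyadic_ball (f x0 / 2)"
      using one_in_dyadic_ball[of "f x0 / 2"] pos one_x0[OF x0] by (metis half_gt_zero image_eqI)
    then have "x0 \<in> C (f x0 / 2)"
      unfolding C_def using x0 by (metis Int_iff closure_of_subset_Int subsetD)
    then have "f x0 \<le> f x0 / 2" using f_le[of "f x0 / 2" x0] pos by simp
    then show False using pos by simp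
  qed
  have C1: "C 1 \<subseteq> U"
  proof -
    have "(\<lambda>g. \<phi> g x0) ` dyadic_ball 1 \<subseteq> V" using dyadic_ball_1_subset N(2) by blast
    then show ?thesis unfolding C_def using clV closure_of_mono by blast
  qed
  have f_out: "f y = 1" if "y \<in> ?E - U" for y
  proof (rule ccontr)
    assume "f y \<noteq> 1"
    then have "f y < 1" using f_0_1[of y] by simp
    then obtain r where "r < 1" "y \<in> C r" using f_less by blast
    then show False using C1 C_mono[of r 1] that by auto
  qed
  have shift: "f (\<phi> g y) \<le> f y + 1 / 2 ^ n" if g: "g \<in> N n" for g y n
  proof -
    have gc: "g \<in> carrier G" using g N_carrier by blast
    have "f (\<phi> g y) - 1 / 2 ^ n \<le> s" if s: "s \<in> insert 1 {r. 0 < r \<and> y \<in> C r}" for s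
    proof (cases "s = 1")
      case True
      moreover have "0 \<le> 1 / (2::real) ^ n" by simp
      ultimately show ?thesis using f_0_1[of "\<phi> g y"] by linarith
    next
      case False
      then have s: "0 < s" "y \<in> C s" using s by auto
      have "\<phi> g y \<in> X closure_of (\<phi> g ` ((\<lambda>h. \<phi> h x0) ` dyadic_ball s))"
        using cont1[OF gc] s(2) unfolding continuous_map_eq_image_closure_subset C_def by blast
      also have "\<dots> \<subseteq> C (s + 1 / 2 ^ n)"
        unfolding C_def
      proof (rule closure_of_mono, clarify)
        fix h assume h: "h \<in> dyadic_ball s"
        then have "h \<in> carrier G" using dyadic_ball_carrier by blast
        then have "\<phi> g (\<phi> h x0) = \<phi> (g \<otimes> h) x0" using composition_rule[OF x0 gc] by simp
        then show "\<phi> g (\<phi> h x0) \<in> (\<lambda>g. \<phi> g x0) ` dyadic_ball (s + 1 / 2 ^ n)"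
          using N_mult_dyadic_ball[OF g h] by blast
      qed
      finally have "f (\<phi> g y) \<le> s + 1 / 2 ^ n" using s by (intro f_le) (auto intro: add_pos_nonneg)
      then show ?thesis by simp
    qed
    then have "f (\<phi> g y) - 1 / 2 ^ n \<le> f y" unfolding f_def[of y] by (intro cInf_greatest) auto
    then show ?thesis by simp
  qed
  have uniform: "\<bar>f (\<phi> g y) - f y\<bar> \<le> 1 / 2 ^ n" if g: "g \<in> N n" and y: "y \<in> ?E" for g y n
  proof -
    have gc: "g \<in> carrier G" using g N_carrier by blast
    have "\<phi> (inv g) (\<phi> g y) = y"
      using orbit_sym_aux gc y by blast
    then have "f y \<le> f (\<phi> g y) + 1 / 2 ^ n" using shift[OF N_inv[OF g], of "\<phi> g y"] by simp
    then show ?thesis using shift[OF g, of y] by simp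
  qed
  have small: "\<exists>n. 1 / 2 ^ n < \<epsilon>" if "\<epsilon> > 0" for \<epsilon> :: real
    using real_arch_pow_inv[OF that, of "1/2"] by (auto simp: power_one_over)
  have closed: "closedin X {y \<in> ?E. f y \<le> a}" for a
  proof -
    consider "a < 0" | "1 \<le> a" | "0 \<le> a" "a < 1" by linarith
    then show ?thesis
    proof cases
      case 1
      then have "{y \<in> ?E. f y \<le> a} = {}" using f_0_1 by (auto simp: not_le intro: less_le_trans)
      then show ?thesis by (simp only: closedin_empty)
    next
      case 2
      then have "{y \<in> ?E. f y \<le> a} = ?E" using f_0_1 order_trans by blast
      then show ?thesis by simp
    next
      case 3
      have "{y \<in> ?E. f y \<le> a} = (\<Inter>r\<in>{a<..}. C r)"
      proof (intro equalityI subsetI)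
        fix y assume y: "y \<in> {y \<in> ?E. f y \<le> a}"
        have "y \<in> C r" if "r \<in> {a<..}" for r
        proof -
          have "f y < min r 1" using y 3 that by auto
          then obtain s where "s < min r 1" "y \<in> C s" using f_less[of y "min r 1"] by auto
          then show ?thesis using C_mono[of s r] by auto
        qed
        then show "y \<in> (\<Inter>r\<in>{a<..}. C r)" by blast
      next
        fix y assume y: "y \<in> (\<Inter>r\<in>{a<..}. C r)"
        have "f y \<le> a"
        proof (rule dense_ge)
          fix r assume "a < r"
          then show "f y \<le> r" using y 3 by (intro f_le) auto
        qed
        moreover have "y \<in> C (a + 1)" using y by auto
        then have "y \<in> ?E" unfolding C_def by (simp add: in_closure_of)
        ultimately show "y \<in> {y \<in> ?E. f y \<le> a}" by blast
      qed
      moreover have "closedin X (\<Inter>r\<in>{a<..}. C r)"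
        by (rule closedin_Inter) (auto simp: C_def)
      ultimately show ?thesis by simp
    qed
  qed
  have "open": "openin X {y \<in> ?E. f y < a}" for a
  proof (subst openin_subopen, intro ballI)
    fix y assume y: "y \<in> {y \<in> ?E. f y < a}"
    then obtain n where n: "1 / 2 ^ n < a - f y" using small[of "a - f y"] by auto
    let ?W = "X interior_of (X closure_of ((\<lambda>g. \<phi> g y) ` N n))"
    have "y \<in> ?W" using act y N(3) N_one unfolding d_open_action_def by blast
    moreover have "?W \<subseteq> {y \<in> ?E. f y < a}"
    proof -
      have "(\<lambda>g. \<phi> g y) ` N n \<subseteq> {z \<in> ?E. f z \<le> f y + 1 / 2 ^ n}"
        using shift y N_carrier element_image by blast
      then have "X closure_of ((\<lambda>g. \<phi> g y) ` N n) \<subseteq> {z \<in> ?E. f z \<le> f y + 1 / 2 ^ n}"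
        using closed by (rule closure_of_minimal)
      then show ?thesis using n interior_of_subset[of X] by fastforce
    qed
    ultimately show "\<exists>W. openin X W \<and> y \<in> W \<and> W \<subseteq> {y \<in> ?E. f y < a}"
      using openin_interior_of by blast
  qed
  show thesis
  proof
    show "continuous_map X euclideanreal f"
      unfolding continuous_map_upper_lower_semicontinuous_lte using closed "open" by blast
    show "\<And>y. 0 \<le> f y \<and> f y \<le> 1" by (rule f_0_1)
    show "f x0 = 0" by (rule f_x0)
    show "\<And>y. y \<in> ?E - U \<Longrightarrow> f y = 1" by (rule f_out)
    fix \<epsilon> :: real assume "\<epsilon> > 0"
    then obtain n where n: "1 / 2 ^ n < \<epsilon>" using small by blast
    then show "\<exists>V. openin T V \<and> \<one> \<in> V \<and> (\<forall>g\<in>V. \<forall>y\<in>?E. \<bar>f (\<phi> g y) - f y\<bar> < \<epsilon>)"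
      using N(3) N_one uniform by (meson le_less_trans)
  qed
qed

text \<open>
Functions are made extensional on \<open>X\<close>, so that functions and transformations compose by \<open>compose\<close> and
equality of members of a family means equality on \<open>X\<close>.
\<close>

definition uniformly_continuous_functions ::
    "('g, 'm) monoid_scheme \<Rightarrow> 'g topology \<Rightarrow> 'a topology \<Rightarrow> ('g \<Rightarrow> 'a \<Rightarrow> 'a) \<Rightarrow> ('a \<Rightarrow> real) set" where
  "uniformly_continuous_functions G T X \<phi> = {f \<in> extensional (topspace X).
     continuous_map X euclideanreal f \<and> (\<forall>x\<in>topspace X. 0 \<le> f x \<and> f x \<le> 1) \<and>
     (\<forall>\<epsilon>>0. \<exists>V. openin T V \<and> \<one>\<^bsub>G\<^esub> \<in> V \<and> (\<forall>g\<in>V. \<forall>x\<in>topspace X. \<bar>f (\<phi> g x) - f x\<bar> < \<epsilon>))}"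

lemma topological_group_conjugate_neighbourhood:
  fixes G (structure)
  assumes TG: "topological_group G T" and V: "openin T V" "\<one> \<in> V" and g: "g \<in> carrier G"
  obtains W where "openin T W" "\<one> \<in> W" "\<And>u. u \<in> W \<Longrightarrow> g \<otimes> u \<otimes> inv g \<in> V"
proof -
  interpret group G using TG by (simp add: topological_group_def)
  have car: "topspace T = carrier G" using TG by (simp add: topological_group_def)
  have mult: "continuous_map T T (\<lambda>u. p u \<otimes> q u)" if "continuous_map T T p" "continuous_map T T q" for p q
  proof -
    have "continuous_map T (prod_topology T T) (\<lambda>u. (p u, q u))" using that by (rule continuous_map_pairedI)
    moreover have "continuous_map (prod_topology T T) T (\<lambda>(g, h). g \<otimes> h)"
      using TG by (simp add: topological_group_def)
    ultimately have "continuous_map T T ((\<lambda>(g, h). g \<otimes> h) \<circ> (\<lambda>u. (p u, q u)))" by (rule continuous_map_compose)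
    then show ?thesis by (simp add: o_def)
  qed
  have "continuous_map T T (\<lambda>u. g \<otimes> u \<otimes> inv g)"
    by (intro mult) (use g car in auto)
  then have "openin T {u \<in> topspace T. g \<otimes> u \<otimes> inv g \<in> V}"
    using V(1) by (rule openin_continuous_map_preimage)
  moreover have "\<one> \<in> {u \<in> topspace T. g \<otimes> u \<otimes> inv g \<in> V}" using V(2) g car by simp
  ultimately show thesis using that by blast
qed

text \<open>
\<open>f (g u x)\<close> differs from \<open>f (g x)\<close> as \<open>f (v y)\<close> from \<open>f y\<close>, with \<open>y = g x\<close> and \<open>v = g u g\<^sup>-\<^sup>1\<close>, and
conjugation is continuous at the unit.
\<close>

lemma uniformly_continuous_functions_compose:
  assumes TG: "topological_group G T" and act: "continuous_action G T X \<phi>"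
    and f: "f \<in> uniformly_continuous_functions G T X \<phi>" and g: "g \<in> carrier G"
  shows "compose (topspace X) f (\<phi> g) \<in> uniformly_continuous_functions G T X \<phi>"
proof -
  let ?E = "topspace X"
  interpret group G using TG by (simp add: topological_group_def)
  have car: "topspace T = carrier G" using TG by (simp add: topological_group_def)
  interpret group_action G ?E \<phi> using act by (simp add: continuous_action_def)
  have cont: "continuous_map X X (\<phi> g)" using continuous_action_map[OF car act g] .
  have "continuous_map X euclideanreal (f \<circ> \<phi> g)"
    using cont f by (intro continuous_map_compose) (auto simp: uniformly_continuous_functions_def)
  then have "continuous_map X euclideanreal (compose ?E f (\<phi> g))"
    by (rule continuous_map_eq) (simp add: compose_def)
  moreover have "0 \<le> compose ?E f (\<phi> g) x \<and> compose ?E f (\<phi> g) x \<le> 1" if "x \<in> ?E" for x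
    using that f element_image[OF g that refl] by (simp add: uniformly_continuous_functions_def compose_def)
  moreover have "\<exists>V. openin T V \<and> \<one>\<^bsub>G\<^esub> \<in> V \<and>
      (\<forall>u\<in>V. \<forall>x\<in>?E. \<bar>compose ?E f (\<phi> g) (\<phi> u x) - compose ?E f (\<phi> g) x\<bar> < \<epsilon>)" if "\<epsilon> > 0" for \<epsilon>
  proof -
    obtain V where V: "openin T V" "\<one>\<^bsub>G\<^esub> \<in> V" "\<forall>u\<in>V. \<forall>x\<in>?E. \<bar>f (\<phi> u x) - f x\<bar> < \<epsilon>"
      using f \<open>\<epsilon> > 0\<close> unfolding uniformly_continuous_functions_def by blast
    obtain W where W: "openin T W" "\<one>\<^bsub>G\<^esub> \<in> W" "\<And>u. u \<in> W \<Longrightarrow> g \<otimes>\<^bsub>G\<^esub> u \<otimes>\<^bsub>G\<^esub> inv\<^bsub>G\<^esub> g \<in> V"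
      using topological_group_conjugate_neighbourhood[OF TG V(1,2) g] by blast
    have "\<bar>compose ?E f (\<phi> g) (\<phi> u x) - compose ?E f (\<phi> g) x\<bar> < \<epsilon>" if u: "u \<in> W" and x: "x \<in> ?E" for u x
    proof -
      have uc: "u \<in> carrier G" using openin_subset[OF W(1)] u car by blast
      have gx: "\<phi> g x \<in> ?E" and ux: "\<phi> u x \<in> ?E" using element_image g uc x by blast+
      have "\<phi> (g \<otimes>\<^bsub>G\<^esub> u \<otimes>\<^bsub>G\<^esub> inv\<^bsub>G\<^esub> g) (\<phi> g x) = \<phi> (g \<otimes>\<^bsub>G\<^esub> u \<otimes>\<^bsub>G\<^esub> inv\<^bsub>G\<^esub> g \<otimes>\<^bsub>G\<^esub> g) x"
        using composition_rule[OF x, of "g \<otimes>\<^bsub>G\<^esub> u \<otimes>\<^bsub>G\<^esub> inv\<^bsub>G\<^esub> g" g] g uc by simp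
      also have "g \<otimes>\<^bsub>G\<^esub> u \<otimes>\<^bsub>G\<^esub> inv\<^bsub>G\<^esub> g \<otimes>\<^bsub>G\<^esub> g = g \<otimes>\<^bsub>G\<^esub> u" using g uc by (simp add: m_assoc)
      also have "\<phi> (g \<otimes>\<^bsub>G\<^esub> u) x = \<phi> g (\<phi> u x)" using composition_rule[OF x g uc] .
      finally show ?thesis using V(3) W(3)[OF u] gx x ux by (metis compose_eq)
    qed
    then show ?thesis using W(1,2) by blast
  qed
  ultimately show ?thesis by (simp add: uniformly_continuous_functions_def)
qed

lemma uniformly_continuous_functions_separating:
  assumes TG: "topological_group G T" and X: "tychonoff_space X"
    and act: "d_open_action G T X \<phi>" and U: "openin X U" "x \<in> U"
  shows "\<exists>f\<in>uniformly_continuous_functions G T X \<phi>. f x < 1/2 \<and> (\<forall>y\<in>topspace X - U. f y \<ge> 1/2)"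
proof -
  let ?E = "topspace X"
  have car: "topspace T = carrier G" using TG by (simp add: topological_group_def)
  interpret group_action G ?E \<phi> using act by (simp add: d_open_action_def continuous_action_def)
  obtain f where f: "continuous_map X euclideanreal f" "\<And>y. 0 \<le> f y \<and> f y \<le> 1" "f x = 0"
    "\<And>y. y \<in> ?E - U \<Longrightarrow> f y = 1"
    and unif: "\<And>\<epsilon>. \<epsilon> > 0 \<Longrightarrow> \<exists>V. openin T V \<and> \<one>\<^bsub>G\<^esub> \<in> V \<and> (\<forall>g\<in>V. \<forall>y\<in>?E. \<bar>f (\<phi> g y) - f y\<bar> < \<epsilon>)"
    using d_open_action_separating_function[OF TG X act U] by metis
  have x: "x \<in> ?E" using U openin_subset by blast
  have "continuous_map X euclideanreal (restrict f ?E)"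
    using f(1) by (rule continuous_map_eq) simp
  moreover have "\<exists>V. openin T V \<and> \<one>\<^bsub>G\<^esub> \<in> V \<and> (\<forall>g\<in>V. \<forall>y\<in>?E. \<bar>restrict f ?E (\<phi> g y) - restrict f ?E y\<bar> < \<epsilon>)"
    if \<epsilon>: "\<epsilon> > 0" for \<epsilon>
  proof -
    obtain V where V: "openin T V" "\<one>\<^bsub>G\<^esub> \<in> V" "\<forall>g\<in>V. \<forall>y\<in>?E. \<bar>f (\<phi> g y) - f y\<bar> < \<epsilon>"
      using unif[OF \<epsilon>] by blast
    have "\<phi> g y \<in> ?E" if "g \<in> V" "y \<in> ?E" for g y
      using element_image openin_subset[OF V(1)] car that by blast
    then show ?thesis using V by (intro exI[of _ V]) simp
  qed
  ultimately have "restrict f ?E \<in> uniformly_continuous_functions G T X \<phi>"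
    using f(2) by (simp add: uniformly_continuous_functions_def)
  then show ?thesis using f x by (intro bexI[of _ "restrict f ?E"]) auto
qed

text \<open>
The set \<open>P\<close> is a parameter because the same finite set of functions defines a neighbourhood of the
identity both in the image of the given group and in its small subgroup, and the two are compared.
\<close>

definition uniform_neighbourhood ::
    "'a topology \<Rightarrow> ('a \<Rightarrow> 'a) set \<Rightarrow> ('a \<Rightarrow> real) set \<Rightarrow> real \<Rightarrow> ('a \<Rightarrow> 'a) set" where
  "uniform_neighbourhood X P S \<epsilon> = {p \<in> P. \<forall>f\<in>S. \<forall>y\<in>topspace X. \<bar>f (p y) - f y\<bar> \<le> \<epsilon>}"

text \<open>
Finitely many uniformly continuous functions admit a common neighbourhood of the unit of \<open>G\<close>, whose image
is contained in the set in question; so d-openness of the original action passes to it.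
\<close>

lemma d_open_action_uniform_neighbourhood:
  assumes TG: "topological_group G T" and act: "d_open_action G T X \<phi>"
    and S: "finite S" "S \<subseteq> uniformly_continuous_functions G T X \<phi>" and \<epsilon>: "\<epsilon> > 0"
    and x: "x \<in> topspace X"
  shows "x \<in> X interior_of (X closure_of ((\<lambda>p. p x) ` uniform_neighbourhood X (\<phi> ` carrier G) S \<epsilon>))"
proof -
  have car: "topspace T = carrier G" and grp: "group G" using TG by (simp_all add: topological_group_def)
  have "\<exists>V. openin T V \<and> \<one>\<^bsub>G\<^esub> \<in> V \<and> (\<forall>g\<in>V. \<forall>f\<in>S. \<forall>y\<in>topspace X. \<bar>f (\<phi> g y) - f y\<bar> \<le> \<epsilon>)"
    using S
  proof (induction S rule: finite_induct)
    case empty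
    have "\<one>\<^bsub>G\<^esub> \<in> topspace T" using car group.is_monoid[OF grp] by (simp add: monoid.one_closed)
    then show ?case using openin_topspace[of T] by blast
  next
    case (insert f S)
    then obtain V where V: "openin T V" "\<one>\<^bsub>G\<^esub> \<in> V" "\<forall>g\<in>V. \<forall>f\<in>S. \<forall>y\<in>topspace X. \<bar>f (\<phi> g y) - f y\<bar> \<le> \<epsilon>"
      by auto
    have "f \<in> uniformly_continuous_functions G T X \<phi>" using insert.prems by blast
    then obtain W where W: "openin T W" "\<one>\<^bsub>G\<^esub> \<in> W" "\<forall>g\<in>W. \<forall>y\<in>topspace X. \<bar>f (\<phi> g y) - f y\<bar> < \<epsilon>"
      using \<epsilon> unfolding uniformly_continuous_functions_def by blast
    show ?case
      by (intro exI[of _ "V \<inter> W"] conjI openin_Int V W(1)) (use V W in \<open>auto intro: less_imp_le\<close>)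
  qed
  then obtain V where V: "openin T V" "\<one>\<^bsub>G\<^esub> \<in> V" "\<forall>g\<in>V. \<forall>f\<in>S. \<forall>y\<in>topspace X. \<bar>f (\<phi> g y) - f y\<bar> \<le> \<epsilon>"
    by blast
  have "x \<in> X interior_of (X closure_of ((\<lambda>g. \<phi> g x) ` V))"
    using act V(1,2) x by (simp add: d_open_action_def)
  moreover have "(\<lambda>g. \<phi> g x) ` V \<subseteq> (\<lambda>p. p x) ` uniform_neighbourhood X (\<phi> ` carrier G) S \<epsilon>"
    using V(3) openin_subset[OF V(1)] car unfolding uniform_neighbourhood_def by blast
  ultimately show ?thesis using interior_of_mono[OF closure_of_mono] by (metis (no_types, lifting) subsetD)
qed

section \<open>The compactification given by an invariant family of functions\<close>

text \<open>
Invariance lets \<open>H\<close> permute the coordinates of \<open>\<real>\<^sup>F\<close>, and separation embeds \<open>X\<close> there. The bounds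
make the closure of \<open>X\<close> compact and the uniform distances of the functions \<open>f \<circ> h\<close> finite.
\<close>

locale invariant_function_family =
  fixes X :: "'a topology" and H :: "('a \<Rightarrow> 'a) set" and F :: "('a \<Rightarrow> real) set"
  assumes X_t1: "t1_space X"
    and H_subgroup: "subgroup H (BijGroup (topspace X))"
    and F_ext: "f \<in> F \<Longrightarrow> f \<in> extensional (topspace X)"
    and F_cont: "f \<in> F \<Longrightarrow> continuous_map X euclideanreal f"
    and F_bounds: "f \<in> F \<Longrightarrow> x \<in> topspace X \<Longrightarrow> 0 \<le> f x \<and> f x \<le> 1"
    and F_invariant: "f \<in> F \<Longrightarrow> h \<in> H \<Longrightarrow> compose (topspace X) f h \<in> F"
    and F_separating: "openin X U \<Longrightarrow> x \<in> U \<Longrightarrow>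
        \<exists>f\<in>F. f x < 1/2 \<and> (\<forall>y\<in>topspace X - U. f y \<ge> 1/2)"
begin

abbreviation E where "E \<equiv> topspace X"

definition transformation_group :: "('a \<Rightarrow> 'a) monoid" where
  "transformation_group = (BijGroup E)\<lparr>carrier := H\<rparr>"

text \<open>
The uniform distance of \<open>f \<circ> g\<close> and \<open>f \<circ> h\<close>. The element \<open>0\<close> is inserted since the supremum of the
empty set of reals is unspecified and \<open>X\<close> may be empty.
\<close>

definition deviation :: "('a \<Rightarrow> real) \<Rightarrow> ('a \<Rightarrow> 'a) \<Rightarrow> ('a \<Rightarrow> 'a) \<Rightarrow> real" where
  "deviation f g h = Sup (insert 0 ((\<lambda>x. \<bar>f (g x) - f (h x)\<bar>) ` E))"

definition deviations :: "('a \<Rightarrow> 'a) \<Rightarrow> ('a \<Rightarrow> real) \<times> ('a \<Rightarrow> 'a) \<Rightarrow> real" where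
  "deviations h = (\<lambda>(f, m)\<in>F \<times> H. deviation f h m)"

text \<open>
The topology of uniform convergence on the functions in \<open>F\<close>. It is written as the topology induced by
the distances to the members of \<open>H\<close>, because an embedding into a power of the real line yields the
Tychonoff property and the bound on the weight at the same time.
\<close>

definition uniform_topology :: "('a \<Rightarrow> 'a) topology" where
  "uniform_topology = pullback_topology H deviations (product_topology (\<lambda>_. euclideanreal) (F \<times> H))"

definition evaluation :: "'a \<Rightarrow> ('a \<Rightarrow> real) \<Rightarrow> real" where
  "evaluation x = (\<lambda>f\<in>F. f x)"

definition limit_points :: "(('a \<Rightarrow> real) \<Rightarrow> real) set" where
  "limit_points = product_topology (\<lambda>_. euclideanreal) F closure_of (evaluation ` E)"

definition compactified :: "(('a \<Rightarrow> real) \<Rightarrow> real) topology" where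
  "compactified = subtopology (product_topology (\<lambda>_. euclideanreal) F) limit_points"

text \<open>
On the image of \<open>X\<close> the coordinate \<open>f\<close> of \<open>h x\<close> is \<open>f (h x)\<close>, which is the coordinate \<open>f \<circ> h\<close> of \<open>x\<close>.
\<close>

definition extended_action :: "('a \<Rightarrow> 'a) \<Rightarrow> (('a \<Rightarrow> real) \<Rightarrow> real) \<Rightarrow> ('a \<Rightarrow> real) \<Rightarrow> real" where
  "extended_action h = (\<lambda>y\<in>limit_points. \<lambda>f\<in>F. y (compose E f h))"

abbreviation P where "P \<equiv> product_topology (\<lambda>_. euclideanreal) F"

lemma H_Bij: "h \<in> H \<Longrightarrow> h \<in> Bij E"
  using subgroup.subset[OF H_subgroup] by (auto simp: BijGroup_def)

lemma H_closed: "h \<in> H \<Longrightarrow> x \<in> E \<Longrightarrow> h x \<in> E"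
  using Bij_imp_funcset[OF H_Bij] by blast

lemma group_transformation_group: "group transformation_group"
  unfolding transformation_group_def using group.subgroup_imp_group[OF group_BijGroup H_subgroup] .

lemma carrier_transformation_group [simp]: "carrier transformation_group = H"
  by (simp add: transformation_group_def)

lemma one_transformation_group: "\<one>\<^bsub>transformation_group\<^esub> = (\<lambda>x\<in>E. x)"
  by (simp add: transformation_group_def BijGroup_def)

lemma one_in_H: "(\<lambda>x\<in>E. x) \<in> H"
  using subgroup.one_closed[OF H_subgroup] by (simp add: BijGroup_def)

lemma mult_transformation_group:
  "g \<in> H \<Longrightarrow> h \<in> H \<Longrightarrow> g \<otimes>\<^bsub>transformation_group\<^esub> h = compose E g h"
  using H_Bij by (simp add: transformation_group_def BijGroup_def)

lemma compose_in_H: "g \<in> H \<Longrightarrow> h \<in> H \<Longrightarrow> compose E g h \<in> H"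
  using subgroup.m_closed[OF H_subgroup, of g h] H_Bij by (simp add: BijGroup_def)

lemma inv_transformation_group:
  "h \<in> H \<Longrightarrow> inv\<^bsub>transformation_group\<^esub> h = (\<lambda>x\<in>E. inv_into E h x)"
  unfolding transformation_group_def
  using group.m_inv_consistent[OF group_BijGroup H_subgroup] inv_BijGroup H_Bij by fastforce

lemma inv_in_H: "h \<in> H \<Longrightarrow> (\<lambda>x\<in>E. inv_into E h x) \<in> H"
  using subgroup.m_inv_closed[OF H_subgroup, of h] inv_BijGroup[OF H_Bij] by simp

lemma H_image: "h \<in> H \<Longrightarrow> h ` E = E"
  using H_Bij by (auto simp: Bij_def bij_betw_def)

lemma inv_into_H: "h \<in> H \<Longrightarrow> x \<in> E \<Longrightarrow> inv_into E h (h x) = x"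
  using H_Bij by (auto simp: Bij_def bij_betw_def)

lemma bdd_deviation:
  assumes "f \<in> F" "g \<in> H" "h \<in> H"
  shows "bdd_above (insert 0 ((\<lambda>x. \<bar>f (g x) - f (h x)\<bar>) ` E))"
proof (rule bdd_aboveI[of _ 1])
  fix s assume "s \<in> insert 0 ((\<lambda>x. \<bar>f (g x) - f (h x)\<bar>) ` E)"
  then consider "s = 0" | x where "x \<in> E" "s = \<bar>f (g x) - f (h x)\<bar>" by blast
  then show "s \<le> 1"
  proof cases
    case 2
    then show ?thesis
      using F_bounds[OF assms(1) H_closed[OF assms(2) 2(1)]] F_bounds[OF assms(1) H_closed[OF assms(3) 2(1)]]
      by linarith
  qed simp
qed

lemma deviation_upper:
  "f \<in> F \<Longrightarrow> g \<in> H \<Longrightarrow> h \<in> H \<Longrightarrow> x \<in> E \<Longrightarrow> \<bar>f (g x) - f (h x)\<bar> \<le> deviation f g h"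
  unfolding deviation_def by (rule cSup_upper[OF _ bdd_deviation]) auto

lemma deviation_nonneg: "f \<in> F \<Longrightarrow> g \<in> H \<Longrightarrow> h \<in> H \<Longrightarrow> 0 \<le> deviation f g h"
  unfolding deviation_def by (rule cSup_upper[OF _ bdd_deviation]) auto

lemma deviation_least:
  "0 \<le> c \<Longrightarrow> (\<And>x. x \<in> E \<Longrightarrow> \<bar>f (g x) - f (h x)\<bar> \<le> c) \<Longrightarrow> deviation f g h \<le> c"
  unfolding deviation_def by (rule cSup_least) auto

lemma deviation_self: "f \<in> F \<Longrightarrow> g \<in> H \<Longrightarrow> deviation f g g = 0"
  by (intro antisym deviation_nonneg deviation_least) auto

lemma deviation_sym: "deviation f g h = deviation f h g"
  by (simp add: deviation_def abs_minus_commute)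

lemma deviation_triangle:
  assumes "f \<in> F" "g \<in> H" "h \<in> H" "k \<in> H"
  shows "deviation f g k \<le> deviation f g h + deviation f h k"
proof (rule deviation_least)
  show "0 \<le> deviation f g h + deviation f h k" using assms deviation_nonneg by simp
  show "\<bar>f (g x) - f (k x)\<bar> \<le> deviation f g h + deviation f h k" if "x \<in> E" for x
    using deviation_upper[OF assms(1,2,3) that] deviation_upper[OF assms(1,3,4) that] by linarith
qed

lemma deviation_diff:
  assumes "f \<in> F" "g \<in> H" "h \<in> H" "k \<in> H"
  shows "\<bar>deviation f g k - deviation f h k\<bar> \<le> deviation f g h"
  using deviation_triangle[of f g h k] deviation_triangle[of f h g k] deviation_sym[of f g h] assms
  by simp

text \<open>
Change one factor at a time. The first change costs the same wherever \<open>h\<close> sends the point, and the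
second is measured by the translated function \<open>f \<circ> g0\<close>, which is in \<open>F\<close> again. This and the next lemma are
the places where invariance of \<open>F\<close> turns uniform convergence into a group topology.
\<close>

lemma deviation_compose:
  assumes "f \<in> F" "g \<in> H" "g0 \<in> H" "h \<in> H" "h0 \<in> H"
  shows "deviation f (compose E g h) (compose E g0 h0) \<le> deviation f g g0 + deviation (compose E f g0) h h0"
proof (rule deviation_least)
  have f': "compose E f g0 \<in> F" using assms F_invariant by blast
  show "0 \<le> deviation f g g0 + deviation (compose E f g0) h h0"
    using assms f' deviation_nonneg by simp
  fix x assume x: "x \<in> E"
  have "\<bar>f (g (h x)) - f (g0 (h x))\<bar> \<le> deviation f g g0"
    using assms x H_closed deviation_upper by blast
  moreover have "\<bar>f (g0 (h x)) - f (g0 (h0 x))\<bar> \<le> deviation (compose E f g0) h h0"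
    using deviation_upper[OF f' assms(4,5) x] assms x H_closed by (simp add: compose_def)
  ultimately show "\<bar>f (compose E g h x) - f (compose E g0 h0 x)\<bar> \<le> deviation f g g0 + deviation (compose E f g0) h h0"
    using x by (simp add: compose_def)
qed

text \<open>
Substitute \<open>x = g y\<close>: then \<open>g\<^sup>-\<^sup>1 x\<close> is \<open>y = h\<^sup>-\<^sup>1 (h y)\<close>, and the values of \<open>f \<circ> h\<^sup>-\<^sup>1\<close> at
\<open>h y\<close> and \<open>g y\<close> are compared.
\<close>

lemma deviation_inverse:
  assumes "f \<in> F" "g \<in> H" "h \<in> H"
  shows "deviation f (\<lambda>x\<in>E. inv_into E g x) (\<lambda>x\<in>E. inv_into E h x)
    \<le> deviation (compose E f (\<lambda>x\<in>E. inv_into E h x)) g h"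
proof (rule deviation_least)
  let ?f = "compose E f (\<lambda>x\<in>E. inv_into E h x)"
  have f': "?f \<in> F" using assms F_invariant inv_in_H by blast
  show "0 \<le> deviation ?f g h" using assms f' deviation_nonneg by blast
  fix x assume x: "x \<in> E"
  define y where "y = inv_into E g x"
  have y: "y \<in> E" "g y = x"
    using x H_image[OF assms(2)] by (auto simp: y_def inv_into_into f_inv_into_f)
  have "\<bar>?f (g y) - ?f (h y)\<bar> \<le> deviation ?f g h" using deviation_upper f' assms y by blast
  then show "\<bar>f ((\<lambda>x\<in>E. inv_into E g x) x) - f ((\<lambda>x\<in>E. inv_into E h x) x)\<bar> \<le> deviation ?f g h"
    using x y H_closed[OF assms(3)] inv_into_H[OF assms(3)] by (simp add: compose_def y_def[symmetric] abs_minus_commute)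
qed

lemma deviations_apply [simp]: "f \<in> F \<Longrightarrow> m \<in> H \<Longrightarrow> deviations h (f, m) = deviation f h m"
  by (simp add: deviations_def)

lemma deviations_extensional: "deviations h \<in> extensional (F \<times> H)"
  by (simp add: deviations_def)

lemma topspace_uniform_topology [simp]: "topspace uniform_topology = H"
  by (auto simp: uniform_topology_def topspace_pullback_topology deviations_def)

text \<open>
Distinct transformations differ at some point, and a function in \<open>F\<close> sees this; so the topology is
Hausdorff because \<open>H\<close> consists of transformations of \<open>X\<close> and \<open>F\<close> separates points.
\<close>

lemma inj_deviations: "inj_on deviations H"
proof (rule inj_onI, rule ccontr)
  fix g h assume gh: "g \<in> H" "h \<in> H" "deviations g = deviations h" "g \<noteq> h"
  then obtain x where x: "x \<in> E" "g x \<noteq> h x"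
    using extensionalityI Bij_imp_extensional H_Bij by metis
  obtain U where U: "openin X U" "g x \<in> U" "h x \<notin> U"
    using X_t1 x H_closed gh unfolding t1_space_def by metis
  then obtain f where f: "f \<in> F" "f (g x) < 1/2" "\<forall>y\<in>E - U. f y \<ge> 1/2"
    using F_separating by blast
  have "f (h x) \<ge> 1/2" using f(3) U(3) H_closed[OF gh(2) x(1)] by blast
  then have "0 < \<bar>f (g x) - f (h x)\<bar>" using f(2) by simp
  also have "\<dots> \<le> deviation f g h" using deviation_upper f(1) gh x by blast
  also have "\<dots> = deviations g (f, h)" using f(1) gh(2) by simp
  also have "\<dots> = deviations h (f, h)" unfolding gh(3) ..
  also have "\<dots> = 0" using f(1) gh deviation_self by simp
  finally show False by simp
qed

lemma embedding_deviations:
  "embedding_map uniform_topology (product_topology (\<lambda>_. euclideanreal) (F \<times> H)) deviations"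
  unfolding uniform_topology_def
  by (rule embedding_map_pullback_topology[OF inj_deviations])
    (simp add: image_subset_iff PiE_iff deviations_extensional)

lemma continuous_deviation:
  assumes "f \<in> F" "m \<in> H"
  shows "continuous_map uniform_topology euclideanreal (\<lambda>h. deviation f h m)"
proof -
  have "continuous_map uniform_topology euclideanreal ((\<lambda>y. y (f, m)) \<circ> deviations)"
    unfolding uniform_topology_def
    by (rule continuous_map_pullback, rule continuous_map_product_projection) (use assms in auto)
  then show ?thesis using assms by (simp add: o_def deviations_def)
qed

lemma continuous_into_uniform_topology:
  assumes u: "\<And>z. z \<in> topspace Z \<Longrightarrow> u z \<in> H"
    and v: "\<And>f z0. f \<in> F \<Longrightarrow> z0 \<in> topspace Z \<Longrightarrow> \<exists>v. continuous_map Z euclideanreal v \<and> v z0 = 0 \<and>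
      (\<forall>z\<in>topspace Z. deviation f (u z) (u z0) \<le> v z)"
  shows "continuous_map Z uniform_topology u"
  unfolding uniform_topology_def
proof (rule continuous_map_pullback')
  show "topspace Z \<subseteq> u -` H" using u by blast
  have "continuous_map Z euclideanreal (\<lambda>z. deviation f (u z) m)" if f: "f \<in> F" "m \<in> H" for f m
  proof (rule continuous_map_real_dominated)
    fix z0 assume z0: "z0 \<in> topspace Z"
    from v[OF f(1) this] obtain v where v: "continuous_map Z euclideanreal v" "v z0 = 0"
      "\<forall>z\<in>topspace Z. deviation f (u z) (u z0) \<le> v z" by blast
    have "\<forall>z\<in>topspace Z. \<bar>deviation f (u z) m - deviation f (u z0) m\<bar> \<le> v z"
      using deviation_diff f u z0 v(3) by (meson order_trans)
    with v(1,2) show "\<exists>v. continuous_map Z euclideanreal v \<and> v z0 = 0 \<and>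
      (\<forall>z\<in>topspace Z. \<bar>deviation f (u z) m - deviation f (u z0) m\<bar> \<le> v z)" by blast
  qed
  then have "continuous_map Z euclideanreal (\<lambda>z. deviations (u z) p)" if "p \<in> F \<times> H" for p
    using that by (auto simp: deviations_def)
  then show "continuous_map Z (product_topology (\<lambda>_. euclideanreal) (F \<times> H)) (deviations \<circ> u)"
    by (auto simp: continuous_map_componentwise deviations_def)
qed

lemma topological_group_transformation_group:
  "topological_group transformation_group uniform_topology"
  unfolding topological_group_def
proof (intro conjI)
  show "group transformation_group" by (rule group_transformation_group)
  show "topspace uniform_topology = carrier transformation_group" by simp
  show "tychonoff_space uniform_topology"
    using tychonoff_space_embedding embedding_deviations tychonoff_space_euclideanreal_product by blast
  let ?Z = "prod_topology uniform_topology uniform_topology"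
  have "continuous_map ?Z uniform_topology (\<lambda>(g, h). compose E g h)"
  proof (rule continuous_into_uniform_topology)
    show "(case z of (g, h) \<Rightarrow> compose E g h) \<in> H" if "z \<in> topspace ?Z" for z
      using that compose_in_H by auto
    fix f z0 assume f: "f \<in> F" and "z0 \<in> topspace ?Z"
    then obtain g0 h0 where z0: "z0 = (g0, h0)" "g0 \<in> H" "h0 \<in> H" by auto
    let ?v = "\<lambda>z. deviation f (fst z) g0 + deviation (compose E f g0) (snd z) h0"
    have f': "compose E f g0 \<in> F" using F_invariant f z0 by blast
    have "continuous_map ?Z euclideanreal ?v"
      using continuous_map_compose[OF continuous_map_fst continuous_deviation[OF f z0(2)]]
        continuous_map_compose[OF continuous_map_snd continuous_deviation[OF f' z0(3)]]
      by (intro continuous_map_add) (auto simp: o_def)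
    moreover have "?v z0 = 0" using deviation_self f f' z0 by simp
    moreover have "deviation f (case z of (g, h) \<Rightarrow> compose E g h) (case z0 of (g, h) \<Rightarrow> compose E g h) \<le> ?v z"
      if "z \<in> topspace ?Z" for z
      using deviation_compose[OF f _ z0(2) _ z0(3)] that z0(1) by auto
    ultimately show "\<exists>v. continuous_map ?Z euclideanreal v \<and> v z0 = 0 \<and> (\<forall>z\<in>topspace ?Z.
        deviation f (case z of (g, h) \<Rightarrow> compose E g h) (case z0 of (g, h) \<Rightarrow> compose E g h) \<le> v z)"
      by blast
  qed
  then show "continuous_map ?Z uniform_topology (\<lambda>(g, h). g \<otimes>\<^bsub>transformation_group\<^esub> h)"
    by (rule continuous_map_eq) (auto simp: mult_transformation_group)
  have "continuous_map uniform_topology uniform_topology (\<lambda>g. \<lambda>x\<in>E. inv_into E g x)"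
  proof (rule continuous_into_uniform_topology)
    show "(\<lambda>x\<in>E. inv_into E g x) \<in> H" if "g \<in> topspace uniform_topology" for g
      using inv_in_H that by simp
    fix f h assume f: "f \<in> F" and h: "h \<in> topspace uniform_topology"
    let ?f = "compose E f (\<lambda>x\<in>E. inv_into E h x)"
    have f': "?f \<in> F" using f h F_invariant inv_in_H by simp
    show "\<exists>v. continuous_map uniform_topology euclideanreal v \<and> v h = 0 \<and>
        (\<forall>g\<in>topspace uniform_topology.
          deviation f (\<lambda>x\<in>E. inv_into E g x) (\<lambda>x\<in>E. inv_into E h x) \<le> v g)"
      by (rule exI[of _ "\<lambda>g. deviation ?f g h"])
        (use f f' h continuous_deviation deviation_self deviation_inverse in auto)
  qed
  then show "continuous_map uniform_topology uniform_topology (\<lambda>g. inv\<^bsub>transformation_group\<^esub> g)"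
    by (rule continuous_map_eq) (auto simp: inv_transformation_group)
qed

lemma uniform_topology_neighbourhood_one:
  assumes U: "openin uniform_topology U" "(\<lambda>x\<in>E. x) \<in> U"
  obtains S \<epsilon> where "finite S" "S \<subseteq> F" "\<epsilon> > 0"
    "\<And>h. h \<in> H \<Longrightarrow> (\<And>f x. f \<in> S \<Longrightarrow> x \<in> E \<Longrightarrow> \<bar>f (h x) - f x\<bar> \<le> \<epsilon>) \<Longrightarrow> h \<in> U"
proof -
  let ?one = "\<lambda>x\<in>E. x"
  obtain W where W: "openin (product_topology (\<lambda>_. euclideanreal) (F \<times> H)) W" "U = deviations -` W \<inter> H"
    using U(1) by (auto simp: uniform_topology_def openin_pullback_topology)
  have "deviations ?one \<in> W" using U(2) W(2) by blast
  then have "\<exists>B. finite {p \<in> F \<times> H. B p \<noteq> topspace euclideanreal} \<and> (\<forall>p\<in>F \<times> H. openin euclideanreal (B p)) \<and>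
      deviations ?one \<in> PiE (F \<times> H) B \<and> PiE (F \<times> H) B \<subseteq> W"
    using W(1) unfolding openin_product_topology_alt by blast
  then obtain B where B: "finite {p \<in> F \<times> H. B p \<noteq> UNIV}" "\<forall>p\<in>F \<times> H. open (B p)"
      "deviations ?one \<in> PiE (F \<times> H) B" "PiE (F \<times> H) B \<subseteq> W"
    by auto
  let ?J = "{p \<in> F \<times> H. B p \<noteq> UNIV}"
  have "\<exists>e>0. ball (deviations ?one p) e \<subseteq> B p" if p: "p \<in> F \<times> H" for p
  proof -
    have "open (B p)" "deviations ?one p \<in> B p" using B(2,3) p by auto
    then show ?thesis using open_contains_ball by blast
  qed
  then obtain e where e: "\<And>p. p \<in> F \<times> H \<Longrightarrow> e p > 0 \<and> ball (deviations ?one p) (e p) \<subseteq> B p"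
    by metis
  \<comment> \<open>Halving makes room for the strict inequality: a supremum of values at most \<open>\<epsilon>\<close> is only known to be at most \<open>\<epsilon>\<close>.\<close>
  define \<epsilon> where "\<epsilon> = Min (insert 1 (e ` ?J)) / 2"
  have \<epsilon>: "\<epsilon> > 0" "\<And>p. p \<in> ?J \<Longrightarrow> \<epsilon> < e p"
  proof -
    have "Min (insert 1 (e ` ?J)) > 0" using B(1) e by (subst Min_gr_iff) auto
    moreover have "Min (insert 1 (e ` ?J)) \<le> e p" if "p \<in> ?J" for p using B(1) that by (intro Min_le) auto
    ultimately show "\<epsilon> > 0" "\<And>p. p \<in> ?J \<Longrightarrow> \<epsilon> < e p" unfolding \<epsilon>_def by force+
  qed
  show thesis
  proof
    show "finite (fst ` ?J)" "fst ` ?J \<subseteq> F" "\<epsilon> > 0" using B(1) \<epsilon>(1) by auto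
    fix h assume h: "h \<in> H" and small: "\<And>f x. f \<in> fst ` ?J \<Longrightarrow> x \<in> E \<Longrightarrow> \<bar>f (h x) - f x\<bar> \<le> \<epsilon>"
    have "deviations h p \<in> B p" if p: "p \<in> F \<times> H" for p
    proof (cases "B p = UNIV")
      case False
      obtain f m where fm: "p = (f, m)" "f \<in> F" "m \<in> H" using p by auto
      have pJ: "p \<in> ?J" using p False by blast
      then have "f \<in> fst ` ?J" using fm(1) by force
      then have "deviation f h ?one \<le> \<epsilon>" using small \<epsilon>(1) by (intro deviation_least) auto
      then have "\<bar>deviation f h m - deviation f ?one m\<bar> < e p"
        using deviation_diff[OF fm(2) h one_in_H fm(3)] \<epsilon>(2)[OF pJ] by linarith
      then have "deviations h p \<in> ball (deviations ?one p) (e p)"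
        using p by (simp add: deviations_def fm(1) dist_real_def abs_minus_commute)
      then show ?thesis using e[OF p] by blast
    qed simp
    then have "deviations h \<in> PiE (F \<times> H) B" by (auto simp: PiE_def deviations_def)
    then show "h \<in> U" using W(2) B(4) h by blast
  qed
qed

lemma evaluation_apply [simp]: "f \<in> F \<Longrightarrow> evaluation x f = f x"
  by (simp add: evaluation_def)

lemma embedding_evaluation: "embedding_map X P evaluation"
  unfolding evaluation_def
  by (rule embedding_map_separating[OF F_cont X_t1 F_separating])

lemma Hausdorff_P: "Hausdorff_space P"
  by (simp add: Hausdorff_space_product_topology)

lemma evaluation_in_topspace: "evaluation x \<in> topspace P"
  by (simp add: evaluation_def PiE_iff)

lemma closedin_limit_points: "closedin P limit_points"
  by (simp add: limit_points_def)

lemma limit_points_subset: "limit_points \<subseteq> topspace P"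
  by (rule closedin_subset[OF closedin_limit_points])

lemma evaluation_in_limit_points: "x \<in> E \<Longrightarrow> evaluation x \<in> limit_points"
  unfolding limit_points_def using closure_of_subset[of "evaluation ` E" P] evaluation_in_topspace by blast

lemma topspace_compactified [simp]: "topspace compactified = limit_points"
  unfolding compactified_def by (rule topspace_subtopology_subset[OF limit_points_subset])

lemma limit_point_apply: "y \<in> limit_points \<Longrightarrow> (\<lambda>f\<in>F. y f) = y"
  using limit_points_subset by (auto simp: PiE_iff extensional_restrict)

lemma compactification_compactified: "compactification X compactified evaluation"
  unfolding compactification_def
proof (intro conjI)
  have "compactin P (PiE F (\<lambda>_. {0..1}))"
    by (simp add: compactin_PiE)
  moreover have "limit_points \<subseteq> PiE F (\<lambda>_. {0..1})"
    unfolding limit_points_def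
  proof (rule closure_of_minimal)
    show "evaluation ` E \<subseteq> PiE F (\<lambda>_. {0..1})" using F_bounds by (auto simp: evaluation_def)
    show "closedin P (PiE F (\<lambda>_. {0..1}))" by (simp add: closedin_product_topology)
  qed
  ultimately have "compactin P limit_points" using closed_compactin closedin_limit_points by blast
  then show "compact_space compactified" unfolding compactified_def by (rule compact_space_subtopology)
  show "Hausdorff_space compactified"
    unfolding compactified_def using Hausdorff_P by (rule Hausdorff_space_subtopology)
  show "embedding_map X compactified evaluation"
    unfolding compactified_def embedding_map_in_subtopology
    using embedding_evaluation evaluation_in_limit_points by blast
  have "evaluation ` E \<subseteq> limit_points" using evaluation_in_limit_points by blast
  then show "compactified closure_of (evaluation ` topspace X) = topspace compactified"
    unfolding topspace_compactified unfolding compactified_def closure_of_subtopology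
    by (simp add: inf.absorb2 limit_points_def)
qed

lemma extended_action_apply:
  "y \<in> limit_points \<Longrightarrow> extended_action h y = (\<lambda>f\<in>F. y (compose E f h))"
  by (simp add: extended_action_def)

lemma extended_action_extensional: "extended_action h \<in> extensional limit_points"
  by (simp add: extended_action_def)

lemma compose_evaluation:
  assumes "h \<in> H" "x \<in> E"
  shows "(\<lambda>f\<in>F. evaluation x (compose E f h)) = evaluation (h x)"
  by (rule ext) (use assms F_invariant in \<open>auto simp: evaluation_def compose_def\<close>)

lemma extended_action_evaluation:
  "h \<in> H \<Longrightarrow> x \<in> E \<Longrightarrow> extended_action h (evaluation x) = evaluation (h x)"
  by (simp add: extended_action_apply evaluation_in_limit_points compose_evaluation)

lemma extended_action_closed:
  assumes h: "h \<in> H" and y: "y \<in> limit_points"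
  shows "extended_action h y \<in> limit_points"
proof -
  let ?s = "\<lambda>y. \<lambda>f\<in>F. y (compose E f h)"
  have "continuous_map P P ?s"
    unfolding continuous_map_componentwise
    using h F_invariant by (auto intro!: continuous_map_product_projection)
  then have "?s ` limit_points \<subseteq> P closure_of (?s ` evaluation ` E)"
    unfolding limit_points_def by (rule continuous_map_image_closure_subset)
  also have "?s ` evaluation ` E \<subseteq> evaluation ` E"
    using compose_evaluation[OF h] H_closed[OF h] by auto
  then have "P closure_of (?s ` evaluation ` E) \<subseteq> limit_points"
    unfolding limit_points_def by (rule closure_of_mono)
  finally show ?thesis using y extended_action_apply by auto
qed

lemma compose_one: "f \<in> F \<Longrightarrow> compose E f (\<lambda>x\<in>E. x) = f"
  by (rule extensionalityI[of _ E]) (auto simp: compose_def F_ext)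

lemma group_action_extended_action:
  "group_action transformation_group limit_points extended_action"
proof (rule group_actionI[OF group_transformation_group])
  fix g h y assume "g \<in> carrier transformation_group" "h \<in> carrier transformation_group"
    and y: "y \<in> limit_points"
  then have gh: "g \<in> H" "h \<in> H" by simp_all
  have eq: "compose E f (compose E g h) = compose E (compose E f g) h" for f
    using compose_assoc[of h E E f g] Bij_imp_funcset[OF H_Bij[OF gh(2)]] by simp
  then show "extended_action (g \<otimes>\<^bsub>transformation_group\<^esub> h) y = extended_action g (extended_action h y)"
    using gh y extended_action_closed[OF gh(2) y] F_invariant[OF _ gh(1)]
    by (simp add: mult_transformation_group extended_action_apply eq cong: restrict_cong)
next
  fix y assume y: "y \<in> limit_points"
  have "(\<lambda>f\<in>F. y (compose E f (\<lambda>x\<in>E. x))) = (\<lambda>f\<in>F. y f)"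
    using compose_one by (simp cong: restrict_cong)
  then show "extended_action \<one>\<^bsub>transformation_group\<^esub> y = y"
    unfolding one_transformation_group extended_action_apply[OF y] limit_point_apply[OF y] .
qed (simp_all add: extended_action_closed extended_action_extensional)

lemma limit_point_deviation:
  assumes y: "y \<in> limit_points" and f: "f \<in> F" and gh: "g \<in> H" "h \<in> H"
  shows "\<bar>y (compose E f g) - y (compose E f h)\<bar> \<le> deviation f g h"
  using y unfolding limit_points_def
proof (rule forall_in_closure_of)
  fix y assume "y \<in> evaluation ` E"
  then obtain x where x: "x \<in> E" "y = evaluation x" by blast
  then show "\<bar>y (compose E f g) - y (compose E f h)\<bar> \<le> deviation f g h"
    using deviation_upper[OF f gh x(1)] F_invariant f gh by (simp add: compose_def)
next
  have "compose E f g \<in> F" "compose E f h \<in> F" using F_invariant f gh by auto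
  then have "continuous_map P euclideanreal (\<lambda>y. \<bar>y (compose E f g) - y (compose E f h)\<bar>)"
    by (intro continuous_map_real_abs continuous_map_diff continuous_map_product_projection)
  then have "closedin P {y \<in> topspace P. \<bar>y (compose E f g) - y (compose E f h)\<bar> \<in> {..deviation f g h}}"
    by (rule closedin_continuous_map_preimage) simp
  then show "closedin P {y \<in> topspace P. \<bar>y (compose E f g) - y (compose E f h)\<bar> \<le> deviation f g h}"
    by simp
qed

text \<open>
In the coordinate \<open>f\<close>, the value at \<open>(h, y)\<close> is within \<open>deviation f h h0\<close> of the coordinate \<open>f \<circ> h0\<close> of
\<open>y\<close>: this holds on the image of \<open>X\<close> and passes to its closure. That coordinate is continuous in \<open>y\<close>, and
joint continuity follows.
\<close>

lemma continuous_action_extended_action: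
  "continuous_action transformation_group uniform_topology compactified extended_action"
  unfolding continuous_action_def
proof
  show "group_action transformation_group (topspace compactified) extended_action"
    using group_action_extended_action by simp
  let ?Z = "prod_topology uniform_topology compactified"
  have "continuous_map ?Z euclideanreal (\<lambda>(h, y). extended_action h y f)" if f: "f \<in> F" for f
  proof (rule continuous_map_real_dominated)
    fix z0 assume "z0 \<in> topspace ?Z"
    then obtain h0 y0 where z0: "z0 = (h0, y0)" "h0 \<in> H" "y0 \<in> limit_points" by auto
    have f': "compose E f h0 \<in> F" using F_invariant f z0 by blast
    let ?v = "\<lambda>z. deviation f (fst z) h0 + \<bar>snd z (compose E f h0) - y0 (compose E f h0)\<bar>"
    have "continuous_map compactified euclideanreal (\<lambda>y. y (compose E f h0))"
      unfolding compactified_def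
      by (intro continuous_map_from_subtopology continuous_map_product_projection f')
    from continuous_map_compose[OF continuous_map_snd this]
    have "continuous_map ?Z euclideanreal (\<lambda>z. snd z (compose E f h0))" by (simp add: o_def)
    moreover from continuous_map_compose[OF continuous_map_fst continuous_deviation[OF f z0(2)]]
    have "continuous_map ?Z euclideanreal (\<lambda>z. deviation f (fst z) h0)" by (simp add: o_def)
    ultimately have "continuous_map ?Z euclideanreal ?v"
      by (intro continuous_map_add continuous_map_real_abs continuous_map_diff) auto
    moreover have "?v z0 = 0" using deviation_self[OF f z0(2)] by (simp add: z0(1))
    moreover have "\<bar>(case z of (h, y) \<Rightarrow> extended_action h y f) - (case z0 of (h, y) \<Rightarrow> extended_action h y f)\<bar> \<le> ?v z"
      if z_in: "z \<in> topspace ?Z" for z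
    proof -
      obtain h y where z: "z = (h, y)" "h \<in> H" "y \<in> limit_points" using z_in by auto
      show ?thesis
        using limit_point_deviation[OF z(3) f z(2) z0(2)] z z0 f
        by (simp add: extended_action_apply)
    qed
    ultimately show "\<exists>v. continuous_map ?Z euclideanreal v \<and> v z0 = 0 \<and> (\<forall>z\<in>topspace ?Z.
      \<bar>(case z of (h, y) \<Rightarrow> extended_action h y f) - (case z0 of (h, y) \<Rightarrow> extended_action h y f)\<bar> \<le> v z)"
      by blast
  qed
  then have comp: "continuous_map ?Z euclideanreal (\<lambda>z. (case z of (h, y) \<Rightarrow> extended_action h y) f)" if "f \<in> F" for f
    using that by (simp add: case_prod_unfold)
  have closed: "(case z of (h, y) \<Rightarrow> extended_action h y) \<in> limit_points" if "z \<in> topspace ?Z" for z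
    using that extended_action_closed by auto
  have "continuous_map ?Z P (\<lambda>(h, y). extended_action h y)"
    unfolding continuous_map_componentwise
  proof (intro conjI ballI comp)
    show "(\<lambda>(h, y). extended_action h y) ` topspace ?Z \<subseteq> extensional F"
      using closed limit_points_subset by (fastforce simp: PiE_iff)
  qed
  then show "continuous_map ?Z compactified (\<lambda>(h, y). extended_action h y)"
    unfolding compactified_def continuous_map_in_subtopology
    using closed unfolding compactified_def by blast
qed

text \<open>
Continuity is pulled back along the embedding from the extended action, which restricts to the action
on \<open>X\<close>.
\<close>

lemma continuous_action_transformation_group:
  "continuous_action transformation_group uniform_topology X (\<lambda>h. h)"
  unfolding continuous_action_def
proof
  show "group_action transformation_group (topspace X) (\<lambda>h. h)"
    by (rule group_actionI[OF group_transformation_group])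
      (auto simp: one_transformation_group mult_transformation_group compose_def H_closed
        intro: Bij_imp_extensional H_Bij)
  let ?Z = "prod_topology uniform_topology X" and ?im = "subtopology compactified (evaluation ` E)"
  have emb: "embedding_map X compactified evaluation"
    using compactification_compactified by (simp add: compactification_def)
  then have cont_ev: "continuous_map X compactified evaluation"
    by (meson continuous_map_in_subtopology embedding_map_def homeomorphic_imp_continuous_map)
  obtain e' where e': "homeomorphic_maps X ?im evaluation e'"
    using emb unfolding embedding_map_def homeomorphic_map_maps by blast
  have "continuous_map ?Z (prod_topology uniform_topology compactified) (\<lambda>z. (fst z, evaluation (snd z)))"
    using continuous_map_compose[OF continuous_map_snd cont_ev, of uniform_topology]
    by (intro continuous_map_pairedI continuous_map_fst) (simp add: o_def)
  then have "continuous_map ?Z compactified ((\<lambda>(h, y). extended_action h y) \<circ> (\<lambda>z. (fst z, evaluation (snd z))))"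
    using continuous_action_extended_action unfolding continuous_action_def
    by (blast intro: continuous_map_compose)
  then have "continuous_map ?Z compactified (\<lambda>(h, x). evaluation (h x))"
    by (rule continuous_map_eq) (auto simp: extended_action_evaluation)
  then have "continuous_map ?Z ?im (\<lambda>(h, x). evaluation (h x))"
    unfolding continuous_map_in_subtopology using H_closed by auto
  moreover have "continuous_map ?im X e'" using e' by (simp add: homeomorphic_maps_def)
  ultimately have "continuous_map ?Z X (e' \<circ> (\<lambda>(h, x). evaluation (h x)))"
    by (rule continuous_map_compose)
  then show "continuous_map ?Z X (\<lambda>(h, x). h x)"
    by (rule continuous_map_eq) (use e' H_closed in \<open>auto simp: homeomorphic_maps_def\<close>)
qed

lemma equivariant_compactification_compactified:
  "equivariant_compactification transformation_group uniform_topology X (\<lambda>h. h)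
    compactified extended_action evaluation"
  unfolding equivariant_compactification_def
  using continuous_action_transformation_group continuous_action_extended_action
    compactification_compactified extended_action_evaluation by simp

lemma weight_compactified_ge: "weight X \<le>o weight compactified"
  using compactification_compactified weight_embedding_le unfolding compactification_def by blast

lemma weight_compactified_le:
  assumes "Cinfinite r" "|F| \<le>o r"
  shows "weight compactified \<le>o r"
proof -
  have "embedding_map compactified P id"
    by (simp add: embedding_map_def) (simp add: compactified_def)
  then have "weight compactified \<le>o weight P" by (rule weight_embedding_le)
  also have "weight P \<le>o r" by (rule weight_euclideanreal_product_le[OF assms])
  finally (ordLeq_transitive) show ?thesis .
qed

text \<open>
The bound by an infinite cardinal says nothing about the exact weight of a finite space; but a finite
space is its own compactification.
\<close>

lemma weight_compactified_finite:
  assumes "finite E"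
  shows "weight compactified =o weight X"
proof -
  have "closedin P (evaluation ` E)"
    using Hausdorff_imp_t1_space[OF Hausdorff_P] assms evaluation_in_topspace
    unfolding t1_space_closedin_finite by blast
  then have "limit_points = evaluation ` E"
    unfolding limit_points_def by (rule closure_of_closedin)
  then have "homeomorphic_map X compactified evaluation"
    using embedding_evaluation by (simp add: embedding_map_def compactified_def)
  then show ?thesis by (rule ordIso_symmetric[OF weight_homeomorphic])
qed

lemma weight_uniform_topology_le:
  assumes "Cinfinite r" "|F| \<le>o r" "|H| \<le>o r"
  shows "weight uniform_topology \<le>o r"
proof -
  have "weight uniform_topology \<le>o weight (product_topology (\<lambda>_. euclideanreal) (F \<times> H))"
    by (rule weight_embedding_le[OF embedding_deviations])
  also have "weight (product_topology (\<lambda>_. euclideanreal) (F \<times> H)) \<le>o r"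
    using assms by (intro weight_euclideanreal_product_le Times_Cinfinite_bound)
  finally (ordLeq_transitive) show ?thesis .
qed

end

section \<open>A small group with the same local orbits\<close>

text \<open>
One function for each pair \<open>(A, W)\<close> of basic open sets that some member of the family separates; for
\<open>x \<in> U\<close> take \<open>W\<close> between \<open>x\<close> and \<open>U\<close>, then \<open>A\<close> inside the set where a separating function is small.
\<close>

lemma small_separating_subfamily:
  assumes r: "Cinfinite r" and w: "weight X \<le>o r"
    and cont: "\<And>f. f \<in> F \<Longrightarrow> continuous_map X euclideanreal f"
    and sep: "\<And>U x. openin X U \<Longrightarrow> x \<in> U \<Longrightarrow> \<exists>f\<in>F. f x < 1/2 \<and> (\<forall>y\<in>topspace X - U. f y \<ge> 1/2)"
  obtains F0 where "F0 \<subseteq> F" "|F0| \<le>o r"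
    "\<And>U x. openin X U \<Longrightarrow> x \<in> U \<Longrightarrow> \<exists>f\<in>F0. f x < 1/2 \<and> (\<forall>y\<in>topspace X - U. f y \<ge> 1/2)"
proof -
  obtain \<B> where \<B>: "base_of \<B> X" "weight X = |\<B>|" by (rule weight_base)
  let ?good = "\<lambda>A W f. f \<in> F \<and> (\<forall>x\<in>A. f x < 1/2) \<and> (\<forall>y\<in>topspace X - W. f y \<ge> 1/2)"
  define I where "I = {(A, W) \<in> \<B> \<times> \<B>. \<exists>f. ?good A W f}"
  define c where "c = (\<lambda>(A, W). SOME f. ?good A W f)"
  have c: "?good A W (c (A, W))" if "(A, W) \<in> I" for A W
  proof -
    have "\<exists>f. ?good A W f" using that unfolding I_def by blast
    from someI_ex[OF this] show ?thesis unfolding c_def by simp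
  qed
  show thesis
  proof
    show "c ` I \<subseteq> F" using c by force
    show "|c ` I| \<le>o r"
    proof (rule card_of_image_ordLeq)
      have "|\<B> \<times> \<B>| \<le>o r" using Times_Cinfinite_bound[OF r] w \<B>(2) by simp
      then show "|I| \<le>o r" by (rule card_of_subset_ordLeq[rotated]) (auto simp: I_def)
    qed
    fix U x assume U: "openin X U" "x \<in> U"
    obtain W where W: "W \<in> \<B>" "x \<in> W" "W \<subseteq> U" using base_of_refine[OF \<B>(1) U] by blast
    obtain f where f: "f \<in> F" "f x < 1/2" "\<forall>y\<in>topspace X - W. f y \<ge> 1/2"
      using sep[OF base_of_imp_openin[OF \<B>(1) W(1)] W(2)] by blast
    have "openin X {z \<in> topspace X. f z \<in> {..<1/2}}"
      by (rule openin_continuous_map_preimage[OF cont[OF f(1)]]) simp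
    moreover have "x \<in> {z \<in> topspace X. f z \<in> {..<1/2}}" using f(2) U openin_subset by auto
    ultimately obtain A where A: "A \<in> \<B>" "x \<in> A" "A \<subseteq> {z \<in> topspace X. f z \<in> {..<1/2}}"
      using base_of_refine[OF \<B>(1)] by blast
    have "?good A W f" using f A(3) by auto
    then have AW: "(A, W) \<in> I" unfolding I_def using A(1) W(1) by blast
    have "c (A, W) x < 1/2 \<and> (\<forall>y\<in>topspace X - U. c (A, W) y \<ge> 1/2)"
      using c[OF AW] A(2) W(3) by blast
    then show "\<exists>f\<in>c ` I. f x < 1/2 \<and> (\<forall>y\<in>topspace X - U. f y \<ge> 1/2)" using AW by blast
  qed
qed

text \<open>
This is the Lindelof property, counted by the weight, of the union of the preimages of an open set under
the maps in \<open>V\<close>.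
For each pair \<open>(A, W)\<close> of basic open sets keep one map from \<open>V\<close> that sends \<open>A\<close> into \<open>W\<close>. If \<open>g x \<in> W\<close>,
then \<open>g\<close> sends a basic neighbourhood \<open>A\<close> of \<open>x\<close> into \<open>W\<close>, and the map kept for \<open>(A, W)\<close> does so too. The
choice depends on the pair alone, which is why one set serves all points of \<open>X\<close>, whose number may exceed
the weight.
\<close>

lemma thin_pointwise_dense_subset:
  assumes r: "Cinfinite r" and w: "weight X \<le>o r"
    and V: "\<And>g. g \<in> V \<Longrightarrow> continuous_map X X g"
  shows "\<exists>C\<subseteq>V. |C| \<le>o r \<and>
    (\<forall>x\<in>topspace X. (\<lambda>g. g x) ` V \<subseteq> X closure_of ((\<lambda>g. g x) ` C))"
proof -
  obtain \<B> where \<B>: "base_of \<B> X" "weight X = |\<B>|" by (rule weight_base)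
  define I where "I = {(A, W) \<in> \<B> \<times> \<B>. \<exists>g\<in>V. g ` A \<subseteq> W}"
  define c where "c = (\<lambda>(A, W). SOME g. g \<in> V \<and> g ` A \<subseteq> W)"
  have c: "c (A, W) \<in> V \<and> c (A, W) ` A \<subseteq> W" if AW: "(A, W) \<in> I" for A W
  proof -
    have "\<exists>g. g \<in> V \<and> g ` A \<subseteq> W" using AW unfolding I_def by blast
    from someI_ex[OF this] show ?thesis unfolding c_def by simp
  qed
  have "c ` I \<subseteq> V" using c by force
  moreover have "|c ` I| \<le>o r"
  proof (rule card_of_image_ordLeq)
    have "|\<B> \<times> \<B>| \<le>o r" using Times_Cinfinite_bound[OF r] w \<B>(2) by simp
    then show "|I| \<le>o r" by (rule card_of_subset_ordLeq[rotated]) (auto simp: I_def)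
  qed
  moreover have "(\<lambda>g. g x) ` V \<subseteq> X closure_of ((\<lambda>g. g x) ` c ` I)" if x: "x \<in> topspace X" for x
  proof clarify
    fix g assume g: "g \<in> V"
    have gx: "g x \<in> topspace X" using V[OF g] x by (simp add: continuous_map_def Pi_iff)
    have "\<exists>y\<in>(\<lambda>g. g x) ` c ` I. y \<in> U" if U: "openin X U" "g x \<in> U" for U
    proof -
      obtain W where W: "W \<in> \<B>" "g x \<in> W" "W \<subseteq> U" using base_of_refine[OF \<B>(1) U] by blast
      have "openin X {z \<in> topspace X. g z \<in> W}"
        using V[OF g] base_of_imp_openin[OF \<B>(1) W(1)] by (rule openin_continuous_map_preimage)
      then obtain A where A: "A \<in> \<B>" "x \<in> A" "A \<subseteq> {z \<in> topspace X. g z \<in> W}"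
        using base_of_refine[OF \<B>(1), of _ x] x W(2) by blast
      then have "(A, W) \<in> I" unfolding I_def using g W(1) by blast
      then have "c (A, W) x \<in> U" using c A(2) W(3) by blast
      then show ?thesis using \<open>(A, W) \<in> I\<close> by blast
    qed
    then show "g x \<in> X closure_of ((\<lambda>g. g x) ` c ` I)" unfolding in_closure_of using gx by blast
  qed
  ultimately show ?thesis by blast
qed

text \<open>
The neighbourhoods to be thinned out depend on the functions \<open>f \<circ> h\<close> with \<open>h \<in> H\<close>, hence on the
group under construction. Each of them involves only finitely many members of \<open>H\<close>, so \<open>H\<close> can be
obtained as a set closed under an operation on finite lists.
\<close>

lemma small_transformation_group_exists:
  fixes G (structure) and X :: "'a topology"
  assumes act: "group_action G (topspace X) \<phi>"
    and maps: "\<And>g. g \<in> carrier G \<Longrightarrow> continuous_map X X (\<phi> g)"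
    and r: "Cinfinite r" and w: "weight X \<le>o r"
    and F0: "|F0| \<le>o r"
  obtains H where "subgroup H (BijGroup (topspace X))" "H \<subseteq> \<phi> ` carrier G" "|H| \<le>o r"
    "\<And>S n x. finite S \<Longrightarrow> S \<subseteq> (\<lambda>(f, h). compose (topspace X) f h) ` (F0 \<times> H) \<Longrightarrow> x \<in> topspace X \<Longrightarrow>
      (\<lambda>p. p x) ` uniform_neighbourhood X (\<phi> ` carrier G) S (1 / real (Suc n))
        \<subseteq> X closure_of ((\<lambda>p. p x) ` uniform_neighbourhood X H S (1 / real (Suc n)))"
proof -
  let ?E = "topspace X"
  interpret group_action G ?E \<phi> by (rule act)
  interpret group_hom G "BijGroup ?E" \<phi> by (rule group_hom)
  define P where "P = \<phi> ` carrier G"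
  have P_subgroup: "subgroup P (BijGroup ?E)" unfolding P_def by (rule img_is_subgroup)
  have P_Bij: "p \<in> Bij ?E" if "p \<in> P" for p using that bij_prop0 by (auto simp: P_def)
  define nbhd where "nbhd S n = uniform_neighbourhood X P S (1 / real (Suc n))" for S n
  have "\<exists>C\<subseteq>V. |C| \<le>o r \<and> (\<forall>x\<in>?E. (\<lambda>g. g x) ` V \<subseteq> X closure_of ((\<lambda>g. g x) ` C))"
    if V: "V \<subseteq> P" for V
    by (rule thin_pointwise_dense_subset[OF r w]) (use V maps in \<open>auto simp: P_def\<close>)
  then obtain thin where thin: "\<And>V. V \<subseteq> P \<Longrightarrow> thin V \<subseteq> V \<and> |thin V| \<le>o r \<and>
      (\<forall>x\<in>?E. (\<lambda>g. g x) ` V \<subseteq> X closure_of ((\<lambda>g. g x) ` thin V))"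
    by metis
  have nbhd_P: "nbhd S n \<subseteq> P" for S n by (auto simp: nbhd_def uniform_neighbourhood_def)
  \<comment> \<open>The list \<open>L\<close> supplies the transformations \<open>h\<close>; pairing the lists over \<open>H\<close> with all lists of functions from \<open>F0\<close> reaches every finite set of functions \<open>f \<circ> h\<close>.\<close>
  define op where "op L = insert (\<lambda>x\<in>?E. x) ((\<lambda>(g, h). compose ?E g h) ` (set L \<times> set L) \<union>
    (\<lambda>h. \<lambda>x\<in>?E. inv_into ?E h x) ` set L \<union>
    (\<Union>(fs, n)\<in>lists F0 \<times> UNIV. thin (nbhd (set (map2 (compose ?E) fs L)) n)))" for L
  have comp: "compose ?E g h \<in> P" if "g \<in> P" "h \<in> P" for g h
    using subgroup.m_closed[OF P_subgroup that] P_Bij that by (simp add: BijGroup_def)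
  have inv: "(\<lambda>x\<in>?E. inv_into ?E h x) \<in> P" if "h \<in> P" for h
    using subgroup.m_inv_closed[OF P_subgroup that] inv_BijGroup[OF P_Bij[OF that]] by simp
  have one: "(\<lambda>x\<in>?E. x) \<in> P" using subgroup.one_closed[OF P_subgroup] by (simp add: BijGroup_def)
  have op: "op L \<subseteq> P \<and> |op L| \<le>o r" if L: "L \<in> lists P" for L
  proof
    have LP: "set L \<subseteq> P" using L by auto
    have thin_P: "thin (nbhd S n) \<subseteq> P" for S n using thin[OF nbhd_P] nbhd_P by blast
    have "(\<lambda>(g, h). compose ?E g h) ` (set L \<times> set L) \<subseteq> P"
      using LP comp by (auto dest!: subsetD[OF LP])
    moreover have "(\<lambda>h. \<lambda>x\<in>?E. inv_into ?E h x) ` set L \<subseteq> P"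
      using LP inv by blast
    moreover have "(\<Union>(fs, n)\<in>lists F0 \<times> UNIV. thin (nbhd (set (map2 (compose ?E) fs L)) n)) \<subseteq> P"
      by (rule UN_least) (use thin_P in \<open>simp add: case_prod_unfold\<close>)
    ultimately show "op L \<subseteq> P" unfolding op_def using one by simp
    have "|\<Union>(fs, n)\<in>lists F0 \<times> (UNIV :: nat set). thin (nbhd (set (map2 (compose ?E) fs L)) n)| \<le>o r"
    proof (rule UNION_Cinfinite_bound[OF _ _ r])
      show "|lists F0 \<times> (UNIV :: nat set)| \<le>o r"
        by (intro Times_Cinfinite_bound lists_Cinfinite_bound r F0 countable_ordLeq_Cinfinite) auto
    qed (use thin[OF nbhd_P] in auto)
    moreover have "|insert (\<lambda>x\<in>?E. x) ((\<lambda>(g, h). compose ?E g h) ` (set L \<times> set L) \<union>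
        (\<lambda>h. \<lambda>x\<in>?E. inv_into ?E h x) ` set L)| \<le>o r"
      by (rule card_of_finite_Cinfinite[OF _ r]) simp
    ultimately show "|op L| \<le>o r"
      unfolding op_def Un_insert_left[symmetric] by (rule Un_Cinfinite_bound[OF _ _ r, rotated])
  qed
  obtain H where H: "H \<subseteq> P" "|H| \<le>o r" "\<And>L. L \<in> lists H \<Longrightarrow> op L \<subseteq> H"
    by (rule finitary_closure_exists[of r P op, OF r op]) (assumption, rule that)
  have H_Bij: "h \<in> Bij ?E" if "h \<in> H" for h using P_Bij H(1) that by blast
  have H_one: "(\<lambda>x\<in>?E. x) \<in> H" using H(3)[of "[]"] by (auto simp: op_def)
  show thesis
  proof
    show "subgroup H (BijGroup ?E)"
    proof (rule group.subgroupI[OF group_BijGroup])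
      show "H \<subseteq> carrier (BijGroup ?E)" using H_Bij by (auto simp: BijGroup_def)
      show "H \<noteq> {}" using H_one by blast
      show "inv\<^bsub>BijGroup ?E\<^esub> h \<in> H" if h: "h \<in> H" for h
      proof -
        have "(\<lambda>x\<in>?E. inv_into ?E h x) \<in> op [h]" by (simp add: op_def)
        then show ?thesis using H(3)[of "[h]"] h inv_BijGroup[OF H_Bij[OF h]] by auto
      qed
      show "g \<otimes>\<^bsub>BijGroup ?E\<^esub> h \<in> H" if gh: "g \<in> H" "h \<in> H" for g h
      proof -
        have "compose ?E g h \<in> op [g, h]" by (simp add: op_def)
        then show ?thesis using H(3)[of "[g, h]"] gh H_Bij by (auto simp: BijGroup_def)
      qed
    qed
    show "H \<subseteq> \<phi> ` carrier G" "|H| \<le>o r" using H(1,2) by (auto simp: P_def)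
    fix S n x
    assume x: "x \<in> ?E" and S: "finite S" "S \<subseteq> (\<lambda>(f, h). compose ?E f h) ` (F0 \<times> H)"
    obtain ps where ps: "set ps = S" using finite_list[OF S(1)] by blast
    have "\<exists>f h. f \<in> F0 \<and> h \<in> H \<and> compose ?E f h = s" if "s \<in> S" for s
      using subsetD[OF S(2) that] by (auto simp: image_iff)
    then obtain a b where ab: "\<And>s. s \<in> S \<Longrightarrow> a s \<in> F0 \<and> b s \<in> H \<and> compose ?E (a s) (b s) = s"
      by metis
    have L: "map b ps \<in> lists H" and fs: "map a ps \<in> lists F0" using ab ps by auto
    have "map2 (compose ?E) (map a ps) (map b ps) = map (\<lambda>s. compose ?E (a s) (b s)) ps"
      by (rule map2_map_map)
    also have "\<dots> = ps" using ab ps by (intro map_idI) blast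
    finally have S_eq: "set (map2 (compose ?E) (map a ps) (map b ps)) = S" using ps by simp
    have "thin (nbhd S n) \<subseteq> op (map b ps)"
    proof -
      have "thin (nbhd S n) \<subseteq> (\<Union>(fs, n)\<in>lists F0 \<times> UNIV. thin (nbhd (set (map2 (compose ?E) fs (map b ps))) n))"
        by (rule SUP_upper2[of "(map a ps, n)"]) (use fs S_eq in auto)
      then show ?thesis unfolding op_def by blast
    qed
    then have "thin (nbhd S n) \<subseteq> H" using H(3)[OF L] by blast
    then have "thin (nbhd S n) \<subseteq> uniform_neighbourhood X H S (1 / real (Suc n))"
      using thin[OF nbhd_P, of S n] by (auto simp: nbhd_def uniform_neighbourhood_def)
    then have "X closure_of ((\<lambda>p. p x) ` thin (nbhd S n))
        \<subseteq> X closure_of ((\<lambda>p. p x) ` uniform_neighbourhood X H S (1 / real (Suc n)))"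
      by (intro closure_of_mono image_mono)
    moreover have "(\<lambda>p. p x) ` nbhd S n \<subseteq> X closure_of ((\<lambda>p. p x) ` thin (nbhd S n))"
      using thin[OF nbhd_P, of S n] x by blast
    ultimately show "(\<lambda>p. p x) ` uniform_neighbourhood X (\<phi> ` carrier G) S (1 / real (Suc n))
        \<subseteq> X closure_of ((\<lambda>p. p x) ` uniform_neighbourhood X H S (1 / real (Suc n)))"
      unfolding nbhd_def P_def by (rule order_trans[rotated])
  qed
qed

theorem theorem5p13:
  fixes G :: "('g, 'm) monoid_scheme" and TG :: "'g topology"
    and X :: "'a topology" and \<alpha> :: "'g \<Rightarrow> 'a \<Rightarrow> 'a"
  assumes "topological_group G TG"
    and "tychonoff_space X"
    and "continuous_action G TG X \<alpha>"
    and "d_open_action G TG X \<alpha>"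
  shows "\<exists>(H :: 'a acting_group) (TH :: ('a \<Rightarrow> 'a) topology) (\<gamma> :: ('a \<Rightarrow> 'a) \<Rightarrow> 'a \<Rightarrow> 'a)
           (bX :: 'a compactification_point topology)
           (\<gamma>' :: ('a \<Rightarrow> 'a) \<Rightarrow> 'a compactification_point \<Rightarrow> 'a compactification_point)
           (e :: 'a \<Rightarrow> 'a compactification_point).
           topological_group H TH \<and>
           equivariant_compactification H TH X \<gamma> bX \<gamma>' e \<and>
           weight bX =o weight X \<and>
           |carrier H| \<le>o natLeq +c weight X \<and> weight TH \<le>o natLeq +c weight X \<and>
           d_open_action H TH X \<gamma> \<and>
           action_components G X \<alpha> = action_components H X \<gamma>"
proof -
  let ?E = "topspace X" and ?r = "natLeq +c weight X"
  let ?UC = "uniformly_continuous_functions G TG X \<alpha>"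
  have car: "topspace TG = carrier G" using assms(1) by (simp add: topological_group_def)
  have act: "group_action G ?E \<alpha>" using assms(3) by (simp add: continuous_action_def)
  have r: "Cinfinite ?r" by (simp add: Cinfinite_csum1 natLeq_Cinfinite)
  have w: "weight X \<le>o ?r" by (rule ordLeq_csum2) (simp add: weight_def card_of_Card_order)
  have t1: "t1_space X" using assms(2) by (simp add: tychonoff_space_def)
  obtain F0 where F0: "F0 \<subseteq> ?UC" "|F0| \<le>o ?r"
    "\<And>U x. openin X U \<Longrightarrow> x \<in> U \<Longrightarrow> \<exists>f\<in>F0. f x < 1/2 \<and> (\<forall>y\<in>?E - U. f y \<ge> 1/2)"
    by (rule small_separating_subfamily[OF r w, of ?UC])
      (use uniformly_continuous_functions_separating[OF assms(1,2,4)]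
        in \<open>auto simp: uniformly_continuous_functions_def\<close>)
  obtain H where H: "subgroup H (BijGroup ?E)" "H \<subseteq> \<alpha> ` carrier G" "|H| \<le>o ?r"
    and dense: "\<And>S n x. finite S \<Longrightarrow> S \<subseteq> (\<lambda>(f, h). compose ?E f h) ` (F0 \<times> H) \<Longrightarrow> x \<in> ?E \<Longrightarrow>
      (\<lambda>p. p x) ` uniform_neighbourhood X (\<alpha> ` carrier G) S (1 / real (Suc n))
        \<subseteq> X closure_of ((\<lambda>p. p x) ` uniform_neighbourhood X H S (1 / real (Suc n)))"
    by (rule small_transformation_group_exists[OF act continuous_action_map[OF car assms(3)] r w F0(2)])
      (assumption, rule that)
  define F where "F = (\<lambda>(f, h). compose ?E f h) ` (F0 \<times> H)"
  have "compose ?E f h \<in> ?UC" if f: "f \<in> F0" and h: "h \<in> H" for f h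
  proof -
    obtain g where "g \<in> carrier G" "h = \<alpha> g" using H(2) h by blast
    then show ?thesis using uniformly_continuous_functions_compose[OF assms(1,3)] F0(1) f by blast
  qed
  then have F_UC: "F \<subseteq> ?UC" by (auto simp: F_def)
  have F_card: "|F| \<le>o ?r"
    unfolding F_def by (intro card_of_image_ordLeq Times_Cinfinite_bound r F0(2) H(3))
  have H_Bij: "h \<in> Bij ?E" if "h \<in> H" for h
    using subgroup.subset[OF H(1)] that by (auto simp: BijGroup_def)
  have F0_F: "F0 \<subseteq> F"
  proof
    fix f assume f: "f \<in> F0"
    have "f \<in> extensional ?E" using f F0(1) by (auto simp: uniformly_continuous_functions_def)
    then have "f = compose ?E f (\<lambda>x\<in>?E. x)"
      by (intro extensionalityI[of _ ?E]) (auto simp: compose_def)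
    moreover have "(\<lambda>x\<in>?E. x) \<in> H" using subgroup.one_closed[OF H(1)] by (simp add: BijGroup_def)
    ultimately show "f \<in> F"
      unfolding F_def using f by (intro image_eqI[of _ _ "(f, \<lambda>x\<in>?E. x)"]) auto
  qed
  interpret invariant_function_family X H F
  proof (rule invariant_function_family.intro)
    show "t1_space X" by (rule t1)
    show "subgroup H (BijGroup ?E)" by (rule H(1))
    fix f assume f: "f \<in> F"
    then have "f \<in> ?UC" using F_UC by blast
    then show "f \<in> extensional ?E" "continuous_map X euclideanreal f"
      "\<And>x. x \<in> ?E \<Longrightarrow> 0 \<le> f x \<and> f x \<le> 1"
      by (auto simp: uniformly_continuous_functions_def)
    fix h assume h: "h \<in> H"
    obtain f0 k where fk: "f = compose ?E f0 k" "f0 \<in> F0" "k \<in> H" using f by (auto simp: F_def)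
    have "compose ?E f h = compose ?E f0 (compose ?E k h)"
      using compose_assoc[of h ?E ?E f0 k] Bij_imp_funcset[OF H_Bij[OF h]] fk(1) by simp
    moreover have "compose ?E k h \<in> H"
      using subgroup.m_closed[OF H(1) fk(3) h] H_Bij fk(3) h by (simp add: BijGroup_def)
    ultimately show "compose ?E f h \<in> F" unfolding F_def using fk(2) by auto
  next
    fix U x assume "openin X U" "x \<in> U"
    then show "\<exists>f\<in>F. f x < 1/2 \<and> (\<forall>y\<in>?E - U. f y \<ge> 1/2)" using F0(3) F0_F by blast
  qed
  have weight_eq: "weight compactified =o weight X"
  proof (cases "finite ?E")
    case True
    then show ?thesis by (rule weight_compactified_finite)
  next
    case False
    have "weight compactified \<le>o ?r" by (rule weight_compactified_le[OF r F_card])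
    then have "weight compactified \<le>o weight X"
      using weight_absorbs_aleph0[OF t1 False] by (rule ordLeq_ordIso_trans)
    then show ?thesis using weight_compactified_ge by (simp add: ordIso_iff_ordLeq)
  qed
  have d_open: "d_open_action transformation_group uniform_topology X (\<lambda>h. h)"
    unfolding d_open_action_def
  proof (intro conjI ballI allI impI continuous_action_transformation_group)
    fix x U assume x: "x \<in> ?E"
      and "openin uniform_topology U \<and> \<one>\<^bsub>transformation_group\<^esub> \<in> U"
    then have "openin uniform_topology U" "(\<lambda>x\<in>?E. x) \<in> U" by (simp_all add: one_transformation_group)
    then obtain S \<epsilon> where S: "finite S" "S \<subseteq> F" "\<epsilon> > 0"
      "\<And>h. h \<in> H \<Longrightarrow> (\<And>f x. f \<in> S \<Longrightarrow> x \<in> ?E \<Longrightarrow> \<bar>f (h x) - f x\<bar> \<le> \<epsilon>) \<Longrightarrow> h \<in> U"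
      using uniform_topology_neighbourhood_one by metis
    obtain n where n: "1 / real (Suc n) < \<epsilon>"
      using reals_Archimedean[OF S(3)] by (auto simp: inverse_eq_divide)
    let ?N = "\<lambda>Q. uniform_neighbourhood X Q S (1 / real (Suc n))"
    have "?N H \<subseteq> U"
    proof
      fix h assume h: "h \<in> ?N H"
      have "\<bar>f (h y) - f y\<bar> \<le> \<epsilon>" if "f \<in> S" "y \<in> ?E" for f y
      proof -
        have "\<bar>f (h y) - f y\<bar> \<le> 1 / real (Suc n)"
          using h that unfolding uniform_neighbourhood_def by blast
        then show ?thesis using n by linarith
      qed
      then show "h \<in> U" using S(4) h by (simp add: uniform_neighbourhood_def)
    qed
    then have "X closure_of ((\<lambda>p. p x) ` ?N H) \<subseteq> X closure_of ((\<lambda>h. h x) ` U)"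
      by (intro closure_of_mono image_mono)
    moreover have "X closure_of ((\<lambda>p. p x) ` ?N (\<alpha> ` carrier G)) \<subseteq> X closure_of ((\<lambda>p. p x) ` ?N H)"
      using dense[OF S(1) _ x] S(2) unfolding F_def by (intro closure_of_minimal) auto
    moreover have "x \<in> X interior_of (X closure_of ((\<lambda>p. p x) ` ?N (\<alpha> ` carrier G)))"
      using S F_UC by (intro d_open_action_uniform_neighbourhood[OF assms(1,4)] x) auto
    ultimately show "x \<in> X interior_of (X closure_of ((\<lambda>h. h x) ` U))"
      using interior_of_mono by (meson subsetD)
  qed
  have components: "X closure_of (orbit G \<alpha> x) = X closure_of (orbit transformation_group (\<lambda>h. h) x)"
    if x: "x \<in> ?E" for x
  proof
    have orb: "orbit G \<alpha> x = (\<lambda>p. p x) ` \<alpha> ` carrier G"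
      "orbit transformation_group (\<lambda>h. h) x = (\<lambda>h. h x) ` H"
      by (auto simp: orbit_def)
    have "(\<lambda>p. p x) ` \<alpha> ` carrier G \<subseteq> X closure_of ((\<lambda>h. h x) ` H)"
      using dense[of "{}" x 0] x by (simp add: uniform_neighbourhood_def)
    then show "X closure_of (orbit G \<alpha> x) \<subseteq> X closure_of (orbit transformation_group (\<lambda>h. h) x)"
      unfolding orb by (rule closure_of_minimal) simp
    show "X closure_of (orbit transformation_group (\<lambda>h. h) x) \<subseteq> X closure_of (orbit G \<alpha> x)"
      unfolding orb using H(2) by (intro closure_of_mono image_mono)
  qed
  have "action_components G X \<alpha> = action_components transformation_group X (\<lambda>h. h)"
    unfolding action_components_def using components by blast
  moreover have "|carrier transformation_group| \<le>o ?r" using H(3) by simp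
  ultimately show ?thesis
    using topological_group_transformation_group equivariant_compactification_compactified
      weight_eq weight_uniform_topology_le[OF r F_card H(3)] d_open by blast
qed

end
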